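(* Let $\mathscr{A}$ be a $C^*$-algebra, let $\mathscr{X}$ be a Hilbert $\mathscr{A}$-module and let $x, y\in\mathscr{X}$. The following statements are equivalent: (i) $x\parallel y$. (ii) There exist a Hilbert space $(\mathscr{H},[\cdot,\cdot])$ such that $\mathscr{A}$ is (identified, via a faithful $*$-representation, with) a $C^*$-subalgebra of $\mathbb{B}(\mathscr{H})$, a sequence of unit vectors $\{\xi_n\}$ in $\mathscr{H}$ and $\lambda\in\mathbb{T}$ such that $$\lim_{n\rightarrow\infty} \mathrm{Re}[\langle x, \lambda y\rangle\xi_n, \xi_n]= \|x\|\,\|y\|.$$
   Context: $\mathscr{A}$ is an arbitrary (not necessarily unital) $C^*$-algebra. A Hilbert $\mathscr{A}$-module is a complex linear space $\mathscr{X}$ that is a right $\mathscr{A}$-module (with compatible scalar multiplication) with an $\mathscr{A}$-valued inner product $\langle\cdot,\cdot\rangle$ that is linear in the second variable, satisfies $\langle x, ya\rangle=\langle x,y\rangle a$, $\langle x,y\rangle^*=\langle y,x\rangle$, $\langle x,x\rangle\ge 0$ with $\langle x,x\rangle=0$ iff $x=0$, and such that $\mathscr{X}$ is complete for the norm $\|x\|=\|\langle x,x\rangle\|^{1/2}$. In a normed space, $x\parallel y$ (norm-parallel) means that $\|x+\lambda y\|=\|x\|+\|y\|$ for some $\lambda\in\mathbb{T}=\{\alpha\in\mathbb{C}:|\alpha|=1\}$. $\mathbb{B}(\mathscr{H})$ is the $C^*$-algebra of bounded operators on the complex Hilbert space $\mathscr{H}$ with inner product $[\cdot,\cdot]$.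 *)

theory Defs
  imports "HOL-Analysis.Analysis" "HOL-Library.Function_Algebras"
begin

class scaleC =
  fixes scaleC :: "complex \<Rightarrow> 'a \<Rightarrow> 'a"  (infixr \<open>*\<^sub>C\<close> 75)

class complex_vector = scaleC + ab_group_add +
  assumes scaleC_add_right: "c *\<^sub>C (x + y) = c *\<^sub>C x + c *\<^sub>C y"
    and scaleC_add_left: "(c + d) *\<^sub>C x = c *\<^sub>C x + d *\<^sub>C x"
    and scaleC_scaleC: "c *\<^sub>C d *\<^sub>C x = (c * d) *\<^sub>C x"
    and scaleC_one: "1 *\<^sub>C x = x"

global_interpretation complex_vector:
  vector_space "scaleC :: complex \<Rightarrow> 'a \<Rightarrow> 'a::complex_vector"
  by unfold_locales (rule scaleC_add_right scaleC_add_left scaleC_scaleC scaleC_one)+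

instantiation complex :: complex_vector
begin
definition scaleC_complex :: "complex \<Rightarrow> complex \<Rightarrow> complex"
  where "scaleC_complex c z = c * z"
instance
  by standard (simp_all add: scaleC_complex_def algebra_simps)
end

instantiation "fun" :: (type, complex_vector) complex_vector
begin
definition scaleC_fun :: "complex \<Rightarrow> ('a \<Rightarrow> 'b) \<Rightarrow> 'a \<Rightarrow> 'b"
  where "scaleC_fun c f = (\<lambda>t. c *\<^sub>C f t)"
instance
  by standard
    (simp_all add: scaleC_fun_def fun_eq_iff scaleC_add_right scaleC_add_left
      scaleC_scaleC scaleC_one)
end

(* Neither a unit nor 0 \<noteq> 1 is assumed, and the zero algebra is allowed. *)
class cstar_algebra = complex_vector + real_normed_algebra + banach +
  fixes star :: "'a \<Rightarrow> 'a"
  assumes scaleR_scaleC: "r *\<^sub>R a = complex_of_real r *\<^sub>C a"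
    and norm_scaleC: "norm (c *\<^sub>C a) = cmod c * norm a"
    and mult_scaleC_left: "(c *\<^sub>C a) * b = c *\<^sub>C (a * b)"
    and mult_scaleC_right: "a * (c *\<^sub>C b) = c *\<^sub>C (a * b)"
    and star_star: "star (star a) = a"
    and star_add: "star (a + b) = star a + star b"
    and star_scaleC: "star (c *\<^sub>C a) = cnj c *\<^sub>C star a"
    and star_mult: "star (a * b) = star b * star a"
    and cstar_identity: "norm (star a * a) = (norm a)\<^sup>2"

definition cstar_nonneg :: "'a::cstar_algebra \<Rightarrow> bool"
  where "cstar_nonneg a \<longleftrightarrow> (\<exists>b. a = star b * b)"

definition module_norm :: "('x \<Rightarrow> 'x \<Rightarrow> 'a::cstar_algebra) \<Rightarrow> 'x \<Rightarrow> real"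
  where "module_norm ip x = sqrt (norm (ip x x))"

(* The distance below is a metric by the Cauchy-Schwarz inequality, which follows from the
   other axioms. *)
locale hilbert_module =
  fixes act :: "'x::complex_vector \<Rightarrow> 'a::cstar_algebra \<Rightarrow> 'x"  (infixl \<open>\<star>\<close> 70)
    and ip :: "'x \<Rightarrow> 'x \<Rightarrow> 'a"
  assumes act_add_left: "(x + y) \<star> a = x \<star> a + y \<star> a"
    and act_add_right: "x \<star> (a + b) = x \<star> a + x \<star> b"
    and act_mult: "x \<star> (a * b) = (x \<star> a) \<star> b"
    and act_scaleC_left: "(c *\<^sub>C x) \<star> a = c *\<^sub>C (x \<star> a)"
    and act_scaleC_right: "x \<star> (c *\<^sub>C a) = c *\<^sub>C (x \<star> a)"
    and ip_add_right: "ip x (y + z) = ip x y + ip x z"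
    and ip_scaleC_right: "ip x (c *\<^sub>C y) = c *\<^sub>C ip x y"
    and ip_act_right: "ip x (y \<star> a) = ip x y * a"
    and star_ip: "star (ip x y) = ip y x"
    and ip_nonneg: "cstar_nonneg (ip x x)"
    and ip_eq_0_iff: "ip x x = 0 \<longleftrightarrow> x = 0"
    and complete: "Metric_space.mcomplete UNIV (\<lambda>x y. module_norm ip (x - y))"

definition norm_parallel :: "('x::complex_vector \<Rightarrow> real) \<Rightarrow> 'x \<Rightarrow> 'x \<Rightarrow> bool"
  where "norm_parallel N x y \<longleftrightarrow> (\<exists>\<mu>. cmod \<mu> = 1 \<and> N (x + \<mu> *\<^sub>C y) = N x + N y)"

definition inner_norm :: "('h \<Rightarrow> 'h \<Rightarrow> complex) \<Rightarrow> 'h \<Rightarrow> real"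
  where "inner_norm br \<xi> = sqrt (Re (br \<xi> \<xi>))"

(* A Hilbert space is a linear subspace H of an ambient complex vector space, used only for its
   linear structure, with an inner product on H that is linear in the first variable.
   Explicit carriers make it possible to quantify existentially over Hilbert spaces. *)
locale hilbert_space =
  fixes H :: "'h::complex_vector set" and br :: "'h \<Rightarrow> 'h \<Rightarrow> complex"
  assumes subspace_H: "complex_vector.subspace H"
    and br_add_left: "\<lbrakk>\<xi> \<in> H; \<eta> \<in> H; \<zeta> \<in> H\<rbrakk> \<Longrightarrow> br (\<xi> + \<eta>) \<zeta> = br \<xi> \<zeta> + br \<eta> \<zeta>"
    and br_scaleC_left: "\<lbrakk>\<xi> \<in> H; \<eta> \<in> H\<rbrakk> \<Longrightarrow> br (c *\<^sub>C \<xi>) \<eta> = c * br \<xi> \<eta>"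
    and br_cnj: "\<lbrakk>\<xi> \<in> H; \<eta> \<in> H\<rbrakk> \<Longrightarrow> cnj (br \<xi> \<eta>) = br \<eta> \<xi>"
    and br_nonneg: "\<xi> \<in> H \<Longrightarrow> 0 \<le> Re (br \<xi> \<xi>)"
    and br_eq_0_iff: "\<xi> \<in> H \<Longrightarrow> br \<xi> \<xi> = 0 \<longleftrightarrow> \<xi> = 0"
    and complete: "Metric_space.mcomplete H (\<lambda>\<xi> \<eta>. inner_norm br (\<xi> - \<eta>))"

(* Values outside H are irrelevant: operators are identified when they agree on H. *)
definition bounded_operator_on ::
    "'h::complex_vector set \<Rightarrow> ('h \<Rightarrow> 'h \<Rightarrow> complex) \<Rightarrow> ('h \<Rightarrow> 'h) \<Rightarrow> bool"
  where "bounded_operator_on H br T \<longleftrightarrow>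
    (\<forall>\<xi>\<in>H. T \<xi> \<in> H) \<and>
    (\<forall>\<xi>\<in>H. \<forall>\<eta>\<in>H. T (\<xi> + \<eta>) = T \<xi> + T \<eta>) \<and>
    (\<forall>c. \<forall>\<xi>\<in>H. T (c *\<^sub>C \<xi>) = c *\<^sub>C T \<xi>) \<and>
    (\<exists>K. \<forall>\<xi>\<in>H. inner_norm br (T \<xi>) \<le> K * inner_norm br \<xi>)"

locale faithful_star_representation = hilbert_space H br
  for H :: "'h::complex_vector set" and br :: "'h \<Rightarrow> 'h \<Rightarrow> complex" +
  fixes \<pi> :: "'a::cstar_algebra \<Rightarrow> 'h \<Rightarrow> 'h"
  assumes bounded_rep: "bounded_operator_on H br (\<pi> a)"
    and rep_add: "\<xi> \<in> H \<Longrightarrow> \<pi> (a + b) \<xi> = \<pi> a \<xi> + \<pi> b \<xi>"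
    and rep_scaleC: "\<xi> \<in> H \<Longrightarrow> \<pi> (c *\<^sub>C a) \<xi> = c *\<^sub>C \<pi> a \<xi>"
    and rep_mult: "\<xi> \<in> H \<Longrightarrow> \<pi> (a * b) \<xi> = \<pi> a (\<pi> b \<xi>)"
    and rep_star: "\<lbrakk>\<xi> \<in> H; \<eta> \<in> H\<rbrakk> \<Longrightarrow> br (\<pi> (star a) \<xi>) \<eta> = br \<xi> (\<pi> a \<eta>)"
    and faithful: "(\<And>\<xi>. \<xi> \<in> H \<Longrightarrow> \<pi> a \<xi> = \<pi> b \<xi>) \<Longrightarrow> a = b"

(* The type argument is the ambient space in which the Hilbert space is sought. *)
definition norm_product_limit ::
    "'h::complex_vector itself \<Rightarrow> ('x::complex_vector \<Rightarrow> 'x \<Rightarrow> 'a::cstar_algebra) \<Rightarrow> 'x \<Rightarrow> 'x \<Rightarrow> bool"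
  where "norm_product_limit _ ip x y \<longleftrightarrow>
    (\<exists>(H :: 'h set) br (\<pi> :: 'a \<Rightarrow> 'h \<Rightarrow> 'h) (\<xi> :: nat \<Rightarrow> 'h) \<mu>.
      faithful_star_representation H br \<pi> \<and>
      (\<forall>n. \<xi> n \<in> H \<and> inner_norm br (\<xi> n) = 1) \<and>
      cmod \<mu> = 1 \<and>
      (\<lambda>n. Re (br (\<pi> (ip x (\<mu> *\<^sub>C y)) (\<xi> n)) (\<xi> n)))
        \<longlonglongrightarrow> module_norm ip x * module_norm ip y)"

(* HOL cannot quantify existentially over types, so existence of a Hilbert space is asserted
   inside one fixed ambient space, depending on the algebra only: families, indexed by the
   functionals on the algebra, of functions on the algebra. It contains the direct sum of all
   GNS spaces, a vector v of the GNS space of a functional being represented by the function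
   sending a to the inner product of v with the class of a. *)
type_synonym 'a gns_ambient = "('a \<Rightarrow> complex) \<Rightarrow> 'a \<Rightarrow> complex"

end

theory Submission
  imports Defs
begin

text \<open>
The proof evaluates positive functionals at inner products. Let \<open>\<phi>\<close> be a positive functional on the
algebra with \<open>Re (\<phi> h) \<le> norm h\<close> for self-adjoint \<open>h\<close>. For \<open>x\<close> and \<open>z = \<mu> y\<close> put
\<open>\<alpha> = \<phi>\<langle>x, x\<rangle>\<close>, \<open>\<beta> = \<phi>\<langle>z, z\<rangle>\<close> and \<open>\<rho> = Re \<phi>\<langle>x, z\<rangle>\<close>. Then \<open>\<phi>\<langle>x + z, x + z\<rangle> = \<alpha> + \<beta> + 2 \<rho>\<close>,
where \<open>\<alpha>\<close> and \<open>\<beta>\<close> are at most the squares of the norms of \<open>x\<close> and \<open>z\<close>, and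
\<open>\<rho>\<^sup>2 \<le> \<alpha> \<beta>\<close> by the Cauchy-Schwarz inequality. So the sum is at most the square of the sum of the two
norms, and it reaches this bound only if \<open>\<rho>\<close> equals their product.

If the norm is additive on \<open>x\<close> and \<open>z\<close>, take for \<open>\<phi>\<close> a state that attains the norm of
\<open>\<langle>x + z, x + z\<rangle>\<close>. It satisfies \<open>\<rho> = \<parallel>x\<parallel> \<parallel>z\<parallel>\<close>, and it is a vector state of the direct sum of all GNS
representations, so a constant sequence of unit vectors suffices. Conversely, let \<open>\<phi>\<close> run through
the vector functionals of the given unit vectors. Since \<open>\<rho>\<close> approaches \<open>\<parallel>x\<parallel> \<parallel>z\<parallel>\<close>, the inequality
\<open>\<rho>\<^sup>2 \<le> \<alpha> \<beta>\<close> forces \<open>\<alpha>\<close> and \<open>\<beta>\<close> to approach the squares of the norms, whence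
\<open>\<parallel>x + z\<parallel> \<ge> \<parallel>x\<parallel> + \<parallel>z\<parallel>\<close> (\<open>functional_ip_lower_bound\<close>).

This rests on two facts about a \<open>C\<^sup>*\<close>-algebra: for every positive element there is a state that
attains its norm, and the universal representation is faithful. The second follows from the first,
and the first is obtained without spectral theory. Its main tool is a square root of
\<open>1 - k\<close> for \<open>norm k \<le> 1\<close>, the limit of an explicit iteration (\<open>quasi_square_root\<close>). In a unital
algebra it shows that a self-adjoint contraction is the real part of a unitary, which gives the
norm estimates for the cone \<open>pos_cone\<close>: it contains all squares, and \<open>\<parallel>1 + p\<parallel> = 1 + \<parallel>p\<parallel>\<close> for each
of its elements (\<open>norm_add_pos_cone\<close>). The decisive step is that every \<open>star b * b\<close> lies in the
cone (\<open>star_mult_in_pos_cone\<close>). It follows Kaplansky's argument, with a comparison of growth of powers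
instead of spectra. A functional that is norming at \<open>1 + p\<close> then is a state that attains the norm
of \<open>p\<close> (\<open>norming_state\<close>). Algebras without unit are treated in their unitization, and the GNS
spaces are completed inside a space of functions, each vector being represented by its inner
products with a family of generators.
\<close>

section \<open>Involution and norm\<close>

lemma star_zero [simp]: "star (0::'a::cstar_algebra) = 0"
  using star_scaleC[of 0 "0::'a"] by simp

lemma star_minus: "star (- a) = - star (a::'a::cstar_algebra)"
  using star_add[of a "- a"] by (simp add: eq_neg_iff_add_eq_0 add.commute)

lemma star_diff: "star (a - b) = star a - star (b::'a::cstar_algebra)"
  using star_add[of a "- b"] by (simp add: star_minus)

lemma star_scaleR: "star (r *\<^sub>R a) = r *\<^sub>R star (a::'a::cstar_algebra)"
  by (simp add: scaleR_scaleC star_scaleC)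

lemma norm_star [simp]: "norm (star a) = norm (a::'a::cstar_algebra)"
proof -
  have le: "norm b \<le> norm (star b)" for b :: 'a
  proof (cases "b = 0")
    case False
    have "norm b * norm b \<le> norm (star b) * norm b"
      using norm_mult_ineq[of "star b" b] by (simp add: cstar_identity power2_eq_square)
    then show ?thesis using False by simp
  qed simp
  show ?thesis using le[of a] le[of "star a"] by (simp add: star_star)
qed

lemma norm_mult_star: "norm (a * star a) = (norm (a::'a::cstar_algebra))\<^sup>2"
  using cstar_identity[of "star a"] by (simp add: star_star)

lemma norm_square_selfadjoint: "star h = h \<Longrightarrow> norm (h * h) = (norm (h::'a::cstar_algebra))\<^sup>2"
  using cstar_identity[of h] by simp

lemma bounded_linear_star: "bounded_linear (star :: 'a::cstar_algebra \<Rightarrow> 'a)"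
  by (rule bounded_linear_intro[where K = 1]) (auto simp: star_add star_scaleR)

section \<open>Square roots by iteration\<close>

text \<open>
A fixed point \<open>b\<close> satisfies \<open>2 b - b\<^sup>2 = k\<close>. In the presence of a unit this says
\<open>(1 - b)\<^sup>2 = 1 - k\<close>, so \<open>1 - b\<close> is a square root of \<open>1 - k\<close>; written in terms of \<open>b\<close> the equation
makes sense in an algebra without unit.
\<close>
primrec sqrt_iter :: "'a::real_normed_algebra \<Rightarrow> nat \<Rightarrow> 'a"
  where "sqrt_iter k 0 = 0"
  | "sqrt_iter k (Suc n) = (1/2) *\<^sub>R (k + sqrt_iter k n * sqrt_iter k n)"

text \<open>
The iterates and their successive differences are polynomials in \<open>k\<close> with nonnegative
coefficients. On the closed unit ball their norms are therefore at most their values at \<open>k = 1\<close>,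
and it suffices to understand one bounded increasing sequence of real numbers. This covers
\<open>norm k = 1\<close>, where the iterated map is no longer a strict contraction.
\<close>
lemma sqrt_iter_majorized:
  assumes "norm k \<le> 1"
  shows "norm (sqrt_iter k n) \<le> sqrt_iter 1 n \<and>
    norm (sqrt_iter k (Suc n) - sqrt_iter k n) \<le> sqrt_iter 1 (Suc n) - (sqrt_iter 1 n :: real)"
proof (induction n)
  case 0
  then show ?case using assms by simp
next
  case (Suc n)
  let ?b = "sqrt_iter k" and ?r = "sqrt_iter (1::real)"
  have r: "?r (Suc n) \<ge> ?r n" using Suc norm_ge_zero order_trans by (smt (verit))
  have r0: "?r n \<ge> 0" using Suc norm_ge_zero order_trans by blast
  have "norm (?b (Suc n)) \<le> norm (?b (Suc n) - ?b n) + norm (?b n)"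
    using norm_triangle_ineq[of "?b (Suc n) - ?b n" "?b n"] by simp
  then have b1: "norm (?b (Suc n)) \<le> ?r (Suc n)" using Suc by linarith
  have gen: "(1/2) *\<^sub>R (k + c * c) - (1/2) *\<^sub>R (k + b * b) = (1/2) *\<^sub>R (c * (c - b) + (c - b) * b)"
    for b c by (simp add: algebra_simps)
  have "?b (Suc (Suc n)) - ?b (Suc n)
      = (1/2) *\<^sub>R (?b (Suc n) * (?b (Suc n) - ?b n) + (?b (Suc n) - ?b n) * ?b n)"
    unfolding sqrt_iter.simps(2)[of k "Suc n"] by (subst (3) sqrt_iter.simps(2)) (rule gen)
  also have "norm \<dots> \<le> (1/2) * (norm (?b (Suc n)) * norm (?b (Suc n) - ?b n) + norm (?b (Suc n) - ?b n) * norm (?b n))"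
    by (simp del: sqrt_iter.simps) (intro norm_triangle_mono norm_mult_ineq)
  also have "\<dots> \<le> (1/2) * (?r (Suc n) * (?r (Suc n) - ?r n) + (?r (Suc n) - ?r n) * ?r n)"
    using Suc b1 r r0 by (intro mult_left_mono add_mono mult_mono) (auto simp del: sqrt_iter.simps)
  also have "\<dots> = ?r (Suc (Suc n)) - ?r (Suc n)"
    by (subst (3 5) sqrt_iter.simps(2)) (simp del: sqrt_iter.simps add: algebra_simps)
  finally show ?case using b1 by blast
qed

lemma quasi_square_root:
  fixes k :: "'a::{real_normed_algebra, banach}"
  assumes k: "norm k \<le> 1"
  obtains b where "norm b \<le> 1" and "2 *\<^sub>R b - b * b = k" and "sqrt_iter k \<longlonglongrightarrow> b"
proof -
  let ?b = "sqrt_iter k" and ?r = "sqrt_iter (1::real)"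
  have r1: "0 \<le> ?r n \<and> ?r n \<le> 1" for n
  proof (induction n)
    case (Suc n)
    then have "?r n * ?r n \<le> 1 * 1" by (intro mult_mono) auto
    then show ?case using Suc by simp
  qed simp
  have maj: "norm (?b n) \<le> ?r n" "norm (?b (Suc n) - ?b n) \<le> ?r (Suc n) - ?r n" for n
    using sqrt_iter_majorized[OF k, of n] by blast+
  have step: "?r n \<le> ?r (Suc n)" for n
    using maj(2)[of n] norm_ge_zero[of "?b (Suc n) - ?b n"] by linarith
  have "incseq ?r" using step by (rule incseq_SucI)
  moreover have "Bseq ?r" using r1 by (intro BseqI'[where K = 1]) auto
  ultimately have "convergent ?r" using Bseq_monoseq_convergent by (auto simp: incseq_imp_monoseq)
  then have conv: "summable (\<lambda>n. ?r (Suc n) - ?r n)"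
    unfolding convergent_def using telescope_summable by blast
  have "summable (\<lambda>n. ?b (Suc n) - ?b n)"
    by (rule summable_comparison_test[OF _ conv]) (use maj(2) in blast)
  then have "convergent (\<lambda>n. \<Sum>i<n. ?b (Suc i) - ?b i)" by (rule summable_iff_convergent[THEN iffD1])
  then have "convergent ?b" unfolding sum_lessThan_telescope by simp
  then obtain b where b: "?b \<longlonglongrightarrow> b" unfolding convergent_def ..
  have "norm b \<le> 1"
    using b maj(1) r1 by (intro Lim_norm_ubound[OF _ b]) (auto intro!: always_eventually order_trans[OF maj(1)])
  moreover have "(\<lambda>n. ?b (Suc n)) \<longlonglongrightarrow> (1/2) *\<^sub>R (k + b * b)"
    unfolding sqrt_iter.simps by (intro tendsto_intros b)
  then have "(1/2) *\<^sub>R (k + b * b) = b"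
    using b LIMSEQ_unique LIMSEQ_Suc by blast
  then have "2 *\<^sub>R b = k + b * b" by (metis scaleR_half_double scaleR_scaleR mult_2 scaleR_2 scaleR_right_distrib)
  ultimately show ?thesis using that b by (simp add: algebra_simps)
qed

lemma sqrt_iter_commute:
  "c * k = k * c \<Longrightarrow> c * sqrt_iter k n = sqrt_iter k n * c"
proof (induction n)
  case (Suc n)
  have "c * (sqrt_iter k n * sqrt_iter k n) = (sqrt_iter k n * sqrt_iter k n) * c"
    using Suc by (metis mult.assoc)
  then show ?case using Suc by (simp add: algebra_simps)
qed simp

lemma sqrt_iter_selfadjoint:
  fixes k :: "'a::cstar_algebra"
  shows "star k = k \<Longrightarrow> star (sqrt_iter k n) = sqrt_iter k n"
  by (induction n) (simp_all add: star_scaleR star_add star_mult)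

text \<open>
The limit is approximated by polynomials in \<open>k\<close> with real coefficients, so it is self-adjoint
with \<open>k\<close> and commutes with whatever commutes with \<open>k\<close>.
\<close>
lemma quasi_square_root_cstar:
  fixes k :: "'a::cstar_algebra"
  assumes k: "norm k \<le> 1" and sa: "star k = k"
  obtains b where "norm b \<le> 1" and "2 *\<^sub>R b - b * b = k" and "star b = b"
    and "\<And>c. c * k = k * c \<Longrightarrow> c * b = b * c"
proof -
  obtain b where b: "norm b \<le> 1" "2 *\<^sub>R b - b * b = k" "sqrt_iter k \<longlonglongrightarrow> b"
    using quasi_square_root[OF k] .
  have "(\<lambda>n. star (sqrt_iter k n)) \<longlonglongrightarrow> star b"
    using b(3) by (rule bounded_linear.tendsto[OF bounded_linear_star])
  then have "star b = b"
    unfolding sqrt_iter_selfadjoint[OF sa] using b(3) LIMSEQ_unique by blast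
  moreover have "c * b = b * c" if c: "c * k = k * c" for c
  proof -
    have "(\<lambda>n. c * sqrt_iter k n) \<longlonglongrightarrow> c * b" "(\<lambda>n. sqrt_iter k n * c) \<longlonglongrightarrow> b * c"
      by (intro tendsto_intros b)+
    then show ?thesis unfolding sqrt_iter_commute[OF c] using LIMSEQ_unique by blast
  qed
  ultimately show ?thesis using b that by blast
qed

section \<open>Norming functionals on real normed spaces\<close>

definition sublinear :: "('a::real_vector \<Rightarrow> real) \<Rightarrow> bool"
  where "sublinear q \<longleftrightarrow> (\<forall>x y. q (x + y) \<le> q x + q y) \<and> (\<forall>t x. 0 \<le> t \<longrightarrow> q (t *\<^sub>R x) = t * q x)"

lemma sublinear_lower_bound:
  assumes "sublinear q"
  shows "- q (- x) \<le> q x"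
proof -
  have "q (0 *\<^sub>R x) = 0 * q x"
    using assms unfolding sublinear_def by blast
  then have "q (x + - x) = 0" by simp
  moreover have "q (x + - x) \<le> q x + q (- x)"
    using assms unfolding sublinear_def by blast
  ultimately show ?thesis by simp
qed

text \<open>
This provides the lower bounds of chains in the application of Zorn's lemma below. Subadditivity
survives the infimum because a single member of \<open>C\<close> lies below any two given ones.
\<close>
lemma sublinear_INF_directed:
  assumes "C \<noteq> {}" and sub: "\<And>q. q \<in> C \<Longrightarrow> sublinear q"
    and directed: "\<And>q r. q \<in> C \<Longrightarrow> r \<in> C \<Longrightarrow> \<exists>s\<in>C. s \<le> q \<and> s \<le> r"
    and bdd: "\<And>x. bdd_below ((\<lambda>q. q x) ` C)"
  shows "sublinear (\<lambda>x. INF q\<in>C. q x)"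
  unfolding sublinear_def
proof (intro conjI allI impI)
  fix x y
  have *: "(INF q\<in>C. q (x + y)) \<le> q x + r y" if qr: "q \<in> C" "r \<in> C" for q r
  proof -
    obtain s where s: "s \<in> C" "s \<le> q" "s \<le> r" using directed[OF qr] by blast
    have "(INF q\<in>C. q (x + y)) \<le> s (x + y)"
      using s bdd by (intro cINF_lower)
    also have "\<dots> \<le> s x + s y" using sub[OF s(1)] unfolding sublinear_def by blast
    also have "\<dots> \<le> q x + r y" using s by (intro add_mono) (auto simp: le_fun_def)
    finally show ?thesis .
  qed
  have "(INF q\<in>C. q (x + y)) - r y \<le> (INF q\<in>C. q x)" if "r \<in> C" for r
    using * that \<open>C \<noteq> {}\<close> by (intro cINF_greatest) (auto simp: algebra_simps)
  then have "(INF q\<in>C. q (x + y)) - (INF q\<in>C. q x) \<le> (INF q\<in>C. q y)"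
    using \<open>C \<noteq> {}\<close> by (intro cINF_greatest) (auto simp: algebra_simps)
  then show "(INF q\<in>C. q (x + y)) \<le> (INF q\<in>C. q x) + (INF q\<in>C. q y)" by simp
next
  fix t :: real and x assume t: "0 \<le> t"
  have hom: "q (t *\<^sub>R x) = t * q x" if "q \<in> C" for q
    using sub[OF that] t unfolding sublinear_def by blast
  then have img: "(\<lambda>q. q (t *\<^sub>R x)) ` C = (\<lambda>q. t * q x) ` C" by auto
  show "(INF q\<in>C. q (t *\<^sub>R x)) = t * (INF q\<in>C. q x)"
  proof (cases "t = 0")
    case True
    then show ?thesis unfolding img using \<open>C \<noteq> {}\<close> by simp
  next
    case False
    then have t: "t > 0" using t by simp
    show ?thesis unfolding img
    proof (rule antisym)
      have "(INF q\<in>C. t * q x) / t \<le> (INF q\<in>C. q x)"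
      proof (rule cINF_greatest[OF \<open>C \<noteq> {}\<close>])
        fix q assume "q \<in> C"
        have "bdd_below ((\<lambda>q. t * q x) ` C)" using bdd[of "t *\<^sub>R x"] unfolding img .
        then have "(INF q\<in>C. t * q x) \<le> t * q x" using \<open>q \<in> C\<close> by (rule cINF_lower)
        then show "(INF q\<in>C. t * q x) / t \<le> q x" using t by (simp add: field_simps)
      qed
      then show "(INF q\<in>C. t * q x) \<le> t * (INF q\<in>C. q x)" using t by (simp add: field_simps)
    next
      show "t * (INF q\<in>C. q x) \<le> (INF q\<in>C. t * q x)"
        using t by (intro cINF_greatest \<open>C \<noteq> {}\<close> mult_left_mono cINF_lower bdd) auto
    qed
  qed
qed

text \<open>
The functional \<open>q\<close> lowered as far as is needed to make it linear in the direction \<open>y\<close>.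
\<close>
definition sublinear_shift :: "('a::real_vector \<Rightarrow> real) \<Rightarrow> 'a \<Rightarrow> 'a \<Rightarrow> real"
  where "sublinear_shift q y x = (INF t\<in>{0..}. q (x + t *\<^sub>R y) - t * q y)"

lemma sublinear_shift:
  assumes q: "sublinear q"
  shows "sublinear (sublinear_shift q y)"
    and "sublinear_shift q y \<le> q"
    and "sublinear_shift q y (- y) \<le> - q y"
proof -
  have add: "q (a + b) \<le> q a + q b" for a b using q unfolding sublinear_def by blast
  have hom: "q (t *\<^sub>R a) = t * q a" if "0 \<le> t" for t a using q that unfolding sublinear_def by blast
  have lower: "- q (- x) \<le> q (x + t *\<^sub>R y) - t * q y" if "t \<in> {0..}" for t x
  proof -
    have "t * q y = q (t *\<^sub>R y)" using hom that by simp
    also have "\<dots> = q ((x + t *\<^sub>R y) + (- x))" by simp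
    also have "\<dots> \<le> q (x + t *\<^sub>R y) + q (- x)" by (rule add)
    finally show ?thesis by simp
  qed
  have bdd: "bdd_below ((\<lambda>t. q (x + t *\<^sub>R y) - t * q y) ` {0..})" for x
    by (rule bdd_belowI2[where m = "- q (- x)"]) (rule lower)
  have le: "sublinear_shift q y x \<le> q (x + t *\<^sub>R y) - t * q y" if "0 \<le> t" for t x
    unfolding sublinear_shift_def using that by (intro cINF_lower bdd) auto
  show "sublinear_shift q y \<le> q"
    using le[of 0] by (auto simp: le_fun_def)
  have q0: "q 0 = 0" using hom[of 0 y] by simp
  show "sublinear_shift q y (- y) \<le> - q y"
    using le[of 1 "- y"] q0 by simp
  have greatest: "m \<le> sublinear_shift q y x" if "\<And>t. 0 \<le> t \<Longrightarrow> m \<le> q (x + t *\<^sub>R y) - t * q y" for m x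
    unfolding sublinear_shift_def using that by (intro cINF_greatest) auto
  show "sublinear (sublinear_shift q y)"
    unfolding sublinear_def
  proof (intro conjI allI impI)
    fix a b
    have *: "sublinear_shift q y (a + b) \<le> (q (a + s *\<^sub>R y) - s * q y) + (q (b + t *\<^sub>R y) - t * q y)"
      if "0 \<le> s" "0 \<le> t" for s t
    proof -
      have "sublinear_shift q y (a + b) \<le> q (a + b + (s + t) *\<^sub>R y) - (s + t) * q y"
        using that by (intro le) auto
      also have "a + b + (s + t) *\<^sub>R y = (a + s *\<^sub>R y) + (b + t *\<^sub>R y)"
        by (simp add: algebra_simps)
      finally show ?thesis using add[of "a + s *\<^sub>R y" "b + t *\<^sub>R y"] by (simp add: algebra_simps)
    qed
    have "sublinear_shift q y (a + b) - (q (b + t *\<^sub>R y) - t * q y) \<le> sublinear_shift q y a" if "0 \<le> t" for t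
      using *[OF _ that] by (intro greatest) (auto simp: algebra_simps)
    then have "sublinear_shift q y (a + b) - sublinear_shift q y a \<le> sublinear_shift q y b"
      by (intro greatest) (auto simp: algebra_simps)
    then show "sublinear_shift q y (a + b) \<le> sublinear_shift q y a + sublinear_shift q y b" by simp
  next
    have le_hom: "sublinear_shift q y (s *\<^sub>R a) \<le> s * sublinear_shift q y a" if "0 < s" for s a
    proof -
      have "sublinear_shift q y (s *\<^sub>R a) / s \<le> sublinear_shift q y a"
      proof (rule greatest)
        fix t :: real assume "0 \<le> t"
        then have "sublinear_shift q y (s *\<^sub>R a) \<le> q (s *\<^sub>R a + (s * t) *\<^sub>R y) - (s * t) * q y"
          using that by (intro le) auto
        also have "s *\<^sub>R a + (s * t) *\<^sub>R y = s *\<^sub>R (a + t *\<^sub>R y)" by (simp add: algebra_simps)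
        also have "q \<dots> = s * q (a + t *\<^sub>R y)" using that by (intro hom) auto
        finally show "sublinear_shift q y (s *\<^sub>R a) / s \<le> q (a + t *\<^sub>R y) - t * q y"
          using that by (simp add: field_simps)
      qed
      then show ?thesis using that by (simp add: field_simps)
    qed
    fix s :: real and a assume s: "0 \<le> s"
    show "sublinear_shift q y (s *\<^sub>R a) = s * sublinear_shift q y a"
    proof (cases "s = 0")
      case True
      have "sublinear_shift q y 0 = 0"
      proof (rule antisym)
        show "sublinear_shift q y 0 \<le> 0" using le[of 0 0] q0 by simp
        show "0 \<le> sublinear_shift q y 0" by (rule greatest) (simp add: hom)
      qed
      with True show ?thesis by simp
    next
      case False
      then have "0 < s" using s by simp
      moreover from this have "sublinear_shift q y (inverse s *\<^sub>R (s *\<^sub>R a)) \<le> inverse s * sublinear_shift q y (s *\<^sub>R a)"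
        by (intro le_hom) auto
      ultimately show ?thesis using le_hom[of s a] by (simp add: field_simps)
    qed
  qed
qed

text \<open>
The Hahn-Banach theorem in its sublinear form. A minimal sublinear functional below \<open>p\<close> exists
by Zorn's lemma. It coincides with all its shifts, and this makes it superadditive.
\<close>
lemma linear_below_sublinear:
  assumes p: "sublinear p"
  obtains g where "linear g" and "g \<le> p"
proof -
  define A where "A = {q. sublinear q \<and> q \<le> p}"
  have bdd: "- p (- x) \<le> q x" if "q \<in> A" for q x
    using that sublinear_lower_bound[of q x] unfolding A_def le_fun_def
    by (smt (verit) mem_Collect_eq)
  have "\<exists>m\<in>A. \<forall>a\<in>A. a \<le> m \<longrightarrow> a = m"
  proof (rule predicate_Zorn)
    show "partial_order_on A (relation_of (\<lambda>q r. r \<le> q) A)"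
      by (rule partial_order_on_relation_ofI) auto
    fix C assume C: "C \<in> Chains (relation_of (\<lambda>q r. r \<le> q) A)"
    then have CA: "C \<subseteq> A" and tot: "\<And>q r. q \<in> C \<Longrightarrow> r \<in> C \<Longrightarrow> q \<le> r \<or> r \<le> q"
      unfolding Chains_def relation_of_def by blast+
    show "\<exists>u\<in>A. \<forall>a\<in>C. u \<le> a"
    proof (cases "C = {}")
      case True
      then show ?thesis using p by (auto simp: A_def)
    next
      case False
      have bddC: "bdd_below ((\<lambda>q. q x) ` C)" for x
        using bdd CA by (intro bdd_belowI2[where m = "- p (- x)"]) blast
      define u where "u = (\<lambda>x. INF q\<in>C. q x)"
      have ul: "u \<le> q" if "q \<in> C" for q
        unfolding u_def le_fun_def using that bddC by (auto intro: cINF_lower)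
      have "sublinear u"
        unfolding u_def
      proof (rule sublinear_INF_directed[OF False _ _ bddC])
        show "sublinear q" if "q \<in> C" for q using that CA by (auto simp: A_def)
        show "\<exists>s\<in>C. s \<le> q \<and> s \<le> r" if "q \<in> C" "r \<in> C" for q r using tot that by blast
      qed
      moreover have "u \<le> p" using False ul CA unfolding A_def by (blast intro: order_trans)
      ultimately show ?thesis using ul by (auto simp: A_def)
    qed
  qed
  then obtain g where g: "sublinear g" "g \<le> p" and min: "\<And>q. q \<in> A \<Longrightarrow> q \<le> g \<Longrightarrow> q = g"
    by (auto simp: A_def)
  have super: "g x + g y \<le> g (x + y)" for x y
  proof -
    have "sublinear_shift g y = g"
      using sublinear_shift[OF g(1), of y] g(2) by (intro min) (auto simp: A_def intro: order_trans)
    have "sublinear_shift g y (x + y + - y) \<le> sublinear_shift g y (x + y) + sublinear_shift g y (- y)"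
      using sublinear_shift(1)[OF g(1), of y] unfolding sublinear_def by blast
    then have "g x \<le> g (x + y) + g (- y)"
      by (simp add: \<open>sublinear_shift g y = g\<close>)
    moreover have "g (- y) \<le> - g y"
      using sublinear_shift(3)[OF g(1), of y] \<open>sublinear_shift g y = g\<close> by simp
    ultimately show ?thesis by simp
  qed
  have sub: "g (x + y) \<le> g x + g y" and hom: "0 \<le> t \<Longrightarrow> g (t *\<^sub>R x) = t * g x" for x y t
    using g(1) unfolding sublinear_def by blast+
  have add: "g (x + y) = g x + g y" for x y
    using super sub by (rule antisym[rotated])
  have neg: "g (- x) = - g x" for x
    using add[of x "- x"] hom[of 0 x] by simp
  have "linear g"
  proof (rule linearI)
    fix t :: real and x
    show "g (t *\<^sub>R x) = t *\<^sub>R g x"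
      using hom[of t x] hom[of "- t" x] neg[of "t *\<^sub>R x"] by (cases "0 \<le> t") auto
  qed (rule add)
  then show ?thesis using g(2) that by blast
qed

text \<open>
A linear functional below the shift of the norm in the direction \<open>v\<close> is at most \<open>- norm v\<close> at
\<open>- v\<close>, which is the lower bound at \<open>v\<close> that is needed.
\<close>
lemma norming_functional:
  fixes v :: "'a::real_normed_vector"
  obtains g :: "'a \<Rightarrow> real" where "linear g" and "\<And>x. g x \<le> norm x" and "g v = norm v"
proof -
  have n: "sublinear (norm :: 'a \<Rightarrow> real)"
    by (simp add: sublinear_def norm_triangle_ineq)
  obtain g where g: "linear g" "g \<le> sublinear_shift norm v"
    using linear_below_sublinear[OF sublinear_shift(1)[OF n]] .
  have le: "g x \<le> norm x" for x
    using g(2) sublinear_shift(2)[OF n, of v] by (meson le_funD order_trans)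
  have "g (- v) \<le> - norm v"
    using g(2) sublinear_shift(3)[OF n, of v] by (meson le_funD order_trans)
  then have "g v = norm v"
    using le[of v] linear_neg[OF g(1), of v] by simp
  with g(1) le that show ?thesis by blast
qed

section \<open>The positive cone of a unital algebra\<close>

lemma star_one [simp]: "star (1::'a::{cstar_algebra, real_normed_algebra_1}) = 1"
  using star_mult[of 1 "star (1::'a)"] by (simp add: star_star)

lemma star_power: "star (z ^ n) = star z ^ n" for z :: "'a::{cstar_algebra, real_normed_algebra_1}"
  by (induction n) (simp_all add: star_mult power_commutes)

text \<open>
The \<open>C\<^sup>*\<close>-identity iterated. It takes the place of the spectral radius formula.
\<close>
lemma norm_power_selfadjoint:
  fixes z :: "'a::{cstar_algebra, real_normed_algebra_1}"
  assumes "star z = z"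
  shows "norm (z ^ (2 ^ m)) = norm z ^ (2 ^ m)"
proof (induction m)
  case (Suc m)
  have "norm (z ^ (2 ^ m) * z ^ (2 ^ m)) = (norm (z ^ (2 ^ m)))\<^sup>2"
    by (rule norm_square_selfadjoint) (simp add: star_power assms)
  moreover have "z ^ (2 ^ Suc m) = z ^ (2 ^ m) * z ^ (2 ^ m)"
    by (simp add: mult_2 power_add)
  ultimately show ?case using Suc by (simp add: power_mult[symmetric] mult.commute)
qed simp

text \<open>
A self-adjoint contraction is the cosine of an angle: with \<open>d = sqrt (1 - h\<^sup>2)\<close>, the element
\<open>u = h + \<i> d\<close> is unitary because \<open>d\<close> commutes with \<open>h\<close>. The two elements in question are the
square of the sine \<open>d\<close> and the cosine \<open>h\<^sup>2 - d\<^sup>2\<close> of the double angle. They are bounded by 1 since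
\<open>d\<close> and \<open>h\<^sup>2 - d\<^sup>2\<close> are the imaginary part of \<open>u\<close> and the real part of \<open>u\<^sup>2\<close>.
\<close>
lemma selfadjoint_contraction_cosine:
  fixes h :: "'a::{cstar_algebra, real_normed_algebra_1}"
  assumes sa: "star h = h" and le: "norm h \<le> 1"
  shows "norm (1 - h * h) \<le> 1" and "norm (2 *\<^sub>R (h * h) - 1) \<le> 1"
proof -
  have "norm (h * h) \<le> 1" using le by (simp add: norm_square_selfadjoint[OF sa] power_le_one)
  moreover have "star (h * h) = h * h" by (simp add: star_mult sa)
  ultimately obtain b where b: "norm b \<le> 1" "2 *\<^sub>R b - b * b = h * h" "star b = b" "h * b = b * h"
    using quasi_square_root_cstar[of "h * h"] by (metis mult.assoc)
  define d where "d = 1 - b"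
  have d: "d * d = 1 - h * h" "star d = d" "d * h = h * d"
    using b by (simp_all add: d_def algebra_simps scaleR_2 star_diff)
  define u where "u = h + \<i> *\<^sub>C d"
  have su: "star u = h - \<i> *\<^sub>C d"
    using d by (simp add: u_def star_add star_scaleC sa complex_vector.scale_minus_left)
  have "star u * u = h * h + d * d"
    unfolding su unfolding u_def
    by (simp add: algebra_simps mult_scaleC_left mult_scaleC_right scaleC_scaleC d(3)
        complex_vector.scale_minus_left scaleC_one)
  then have "norm u = 1" using cstar_identity[of u] d(1) norm_ge_zero[of u]
    by (simp add: power2_eq_1_iff)
  have prod: "norm (x * y) \<le> 1" if "norm x \<le> 1" "norm y \<le> 1" for x y :: 'a
    using that by (intro order_trans[OF norm_mult_ineq]) (simp add: mult_le_one)
  have "u - star u = (2 * \<i>) *\<^sub>C d"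
    unfolding su unfolding u_def by (simp add: scaleC_add_left[symmetric])
  then have "2 * norm d = norm (u - star u)" by (simp add: norm_scaleC norm_mult)
  also have "\<dots> \<le> 2" using norm_triangle_ineq4[of u "star u"] \<open>norm u = 1\<close> by simp
  finally have "norm d \<le> 1" by simp
  then show "norm (1 - h * h) \<le> 1" using prod[of d d] d(1) by simp
  have "u * u + star u * star u = 2 *\<^sub>R (h * h) - 2 *\<^sub>R (d * d)"
    unfolding su unfolding u_def
    by (simp add: algebra_simps mult_scaleC_left mult_scaleC_right scaleC_scaleC
        complex_vector.scale_minus_left scaleC_one scaleR_2)
  then have "2 *\<^sub>R (2 *\<^sub>R (h * h) - 1) = u * u + star u * star u"
    by (simp add: d(1) algebra_simps scaleR_2)
  then have "2 * norm (2 *\<^sub>R (h * h) - 1) \<le> norm (u * u) + norm (star u * star u)"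
    by (metis norm_scaleR abs_numeral norm_triangle_ineq)
  also have "\<dots> \<le> 2" using prod[of u u] prod[of "star u" "star u"] \<open>norm u = 1\<close> by simp
  finally show "norm (2 *\<^sub>R (h * h) - 1) \<le> 1" by simp
qed

text \<open>
Positivity expressed by the norm: for self-adjoint \<open>w\<close>, the inequality says that the spectrum of
\<open>w\<close> is contained in the interval from \<open>0\<close> to \<open>2 t\<close>. In this form sums of positive elements are
positive by the triangle inequality.
\<close>
definition pos_cone :: "'a::{cstar_algebra, real_normed_algebra_1} set"
  where "pos_cone = {w. star w = w \<and> (\<exists>t\<ge>0. norm (t *\<^sub>R 1 - w) \<le> t)}"

lemma pos_cone_add:
  assumes "v \<in> pos_cone" "w \<in> pos_cone"
  shows "v + w \<in> pos_cone"
proof -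
  obtain s t where st: "0 \<le> s" "norm (s *\<^sub>R 1 - v) \<le> s" "0 \<le> t" "norm (t *\<^sub>R 1 - w) \<le> t"
    using assms by (auto simp: pos_cone_def)
  have "(s + t) *\<^sub>R 1 - (v + w) = (s *\<^sub>R 1 - v) + (t *\<^sub>R 1 - w)"
    by (simp add: algebra_simps)
  then have "norm ((s + t) *\<^sub>R 1 - (v + w)) \<le> s + t"
    using norm_triangle_ineq[of "s *\<^sub>R 1 - v" "t *\<^sub>R 1 - w"] st by (simp only:)
  then show ?thesis using assms st by (auto simp: pos_cone_def star_add intro!: exI[of _ "s + t"])
qed

lemma pos_cone_scaleR:
  assumes "w \<in> pos_cone" "0 \<le> r"
  shows "r *\<^sub>R w \<in> pos_cone"
proof -
  obtain t where t: "0 \<le> t" "norm (t *\<^sub>R 1 - w) \<le> t"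
    using assms by (auto simp: pos_cone_def)
  have "(r * t) *\<^sub>R 1 - r *\<^sub>R w = r *\<^sub>R (t *\<^sub>R 1 - w)"
    by (simp add: algebra_simps)
  then have "norm ((r * t) *\<^sub>R 1 - r *\<^sub>R w) \<le> r * t"
    using t assms by (simp add: mult_left_mono)
  then show ?thesis using assms t by (auto simp: pos_cone_def star_scaleR intro!: exI[of _ "r * t"])
qed

lemma norm_diff_square_le:
  fixes h :: "'a::{cstar_algebra, real_normed_algebra_1}"
  assumes sa: "star h = h"
  shows "norm ((norm h)\<^sup>2 *\<^sub>R 1 - h * h) \<le> (norm h)\<^sup>2"
proof (cases "h = 0")
  case False
  let ?r = "norm h" and ?h = "inverse (norm h) *\<^sub>R h"
  have "norm (1 - ?h * ?h) \<le> 1"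
    using False by (intro selfadjoint_contraction_cosine) (simp_all add: star_scaleR sa)
  moreover have "?r\<^sup>2 *\<^sub>R 1 - h * h = ?r\<^sup>2 *\<^sub>R (1 - ?h * ?h)"
    using False by (simp add: algebra_simps power2_eq_square)
  ultimately show ?thesis by (simp add: mult_left_le)
qed simp

lemma square_in_pos_cone: "star h = h \<Longrightarrow> h * h \<in> pos_cone"
  using norm_diff_square_le[of h] by (auto simp: pos_cone_def star_mult intro!: exI[of _ "(norm h)\<^sup>2"])

text \<open>
The inequality that defines the cone says that \<open>w = t (1 - k)\<close> with \<open>norm k \<le> 1\<close>. The quasi square
root \<open>b\<close> of \<open>k\<close> then gives the square root \<open>sqrt t (1 - b)\<close> of \<open>w\<close>.
\<close>
lemma pos_cone_sqrt:
  assumes "w \<in> pos_cone"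
  obtains h where "h \<in> pos_cone" and "h * h = w" and "\<And>c. c * w = w * c \<Longrightarrow> c * h = h * c"
proof -
  obtain t where t: "0 \<le> t" "norm (t *\<^sub>R 1 - w) \<le> t" and sa: "star w = w"
    using assms by (auto simp: pos_cone_def)
  show thesis
  proof (cases "t = 0")
    case True
    then have "w = 0" using t by simp
    then show thesis using that[of 0] by (auto simp: pos_cone_def intro: exI[of _ 0])
  next
    case False
    then have "t > 0" using t by simp
    define k where "k = 1 - inverse t *\<^sub>R w"
    have "inverse t *\<^sub>R (t *\<^sub>R 1 - w) = k" using False by (simp add: k_def algebra_simps)
    then have "norm k = inverse t * norm (t *\<^sub>R 1 - w)" using \<open>t > 0\<close> by (metis norm_scaleR abs_of_pos positive_imp_inverse_positive)
    then have "norm k \<le> inverse t * t" using t(2) \<open>t > 0\<close> by (simp only:) (intro mult_left_mono; simp)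
    then have "norm k \<le> 1" using False by simp
    moreover have "star k = k" by (simp add: k_def star_diff star_scaleR sa)
    ultimately obtain b where b: "norm b \<le> 1" "2 *\<^sub>R b - b * b = k" "star b = b"
      and comm: "\<And>c. c * k = k * c \<Longrightarrow> c * b = b * c"
      using quasi_square_root_cstar by blast
    define h where "h = sqrt t *\<^sub>R (1 - b)"
    have "h * h = t *\<^sub>R (1 - (2 *\<^sub>R b - b * b))"
      using \<open>t > 0\<close> by (simp add: h_def algebra_simps scaleR_2)
    also have "\<dots> = w" using False by (simp add: b(2) k_def)
    finally have "h * h = w" .
    moreover have "h \<in> pos_cone"
      unfolding pos_cone_def
    proof (intro CollectI conjI exI[of _ "sqrt t"])
      have "sqrt t *\<^sub>R 1 - h = sqrt t *\<^sub>R b" by (simp add: h_def algebra_simps)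
      then show "norm (sqrt t *\<^sub>R 1 - h) \<le> sqrt t" using b(1) t by (simp add: mult_left_le)
    qed (use t b in \<open>simp_all add: h_def star_scaleR star_diff\<close>)
    moreover have "c * h = h * c" if "c * w = w * c" for c
    proof -
      have "c * k = k * c" using that by (simp add: k_def algebra_simps)
      then show ?thesis using comm[of c] by (simp add: h_def algebra_simps)
    qed
    ultimately show thesis using that by blast
  qed
qed

text \<open>
A positive element attains its norm in the direction of the unit. With \<open>w = h\<^sup>2\<close> and \<open>r\<close> half the
norm of \<open>w\<close>, the element \<open>w\<close> equals \<open>r (1 + a)\<close>, where \<open>a\<close> is the cosine of the double angle
of the normalized \<open>h\<close>. Hence \<open>norm a \<le> 1\<close> and \<open>norm (1 + a) = 2\<close>, and the triangle inequality
leaves no room for \<open>(m + r) + r a\<close> to have norm less than \<open>m + 2 r\<close>.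
\<close>
lemma norm_add_pos_cone:
  assumes w: "w \<in> pos_cone" and m: "0 \<le> m"
  shows "norm (m *\<^sub>R 1 + w) = m + norm w"
proof -
  obtain h where h: "h \<in> pos_cone" "h * h = w" using pos_cone_sqrt[OF w] by blast
  then have sa: "star h = h" by (simp add: pos_cone_def)
  show ?thesis
  proof (cases "h = 0")
    case True
    then show ?thesis using h m by simp
  next
    case False
    define r where "r = (norm h)\<^sup>2 / 2"
    have "r > 0" using False by (simp add: r_def)
    have nw: "norm w = 2 * r" using norm_square_selfadjoint[OF sa] h by (simp add: r_def)
    define a where "a = inverse r *\<^sub>R w - 1"
    have "a = 2 *\<^sub>R ((inverse (norm h) *\<^sub>R h) * (inverse (norm h) *\<^sub>R h)) - 1"
      using False by (simp add: a_def r_def h power2_eq_square field_simps)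
    then have "norm a \<le> 1"
      using False selfadjoint_contraction_cosine(2)[of "inverse (norm h) *\<^sub>R h"]
      by (simp add: star_scaleR sa)
    have wa: "w = r *\<^sub>R (1 + a)" using \<open>r > 0\<close> by (simp add: a_def)
    then have "norm (1 + a) = 2" using nw \<open>r > 0\<close> by simp
    have "(m + r) *\<^sub>R (1 + a) = (m *\<^sub>R 1 + w) + m *\<^sub>R a"
      by (simp add: wa algebra_simps)
    then have "(m + r) * 2 \<le> norm (m *\<^sub>R 1 + w) + m * norm a"
      using norm_triangle_ineq[of "m *\<^sub>R 1 + w" "m *\<^sub>R a"] m \<open>r > 0\<close> \<open>norm (1 + a) = 2\<close>
      by (metis (no_types, lifting) abs_of_nonneg add_nonneg_nonneg less_imp_le norm_scaleR)
    moreover have "m * norm a \<le> m" using \<open>norm a \<le> 1\<close> m by (simp add: mult_left_le)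
    moreover have "norm (m *\<^sub>R 1 + w) \<le> m + norm w"
      using norm_triangle_ineq[of "m *\<^sub>R 1" w] m by simp
    ultimately show ?thesis using nw by simp
  qed
qed

lemma pos_cone_antisym:
  assumes "w \<in> pos_cone" "- w \<in> pos_cone"
  shows "w = 0"
proof -
  obtain t where t: "0 \<le> t" "norm (t *\<^sub>R 1 - w) \<le> t"
    using assms(1) by (auto simp: pos_cone_def)
  have "norm (t *\<^sub>R 1 - w) = t + norm w"
    using norm_add_pos_cone[OF assms(2) t(1)] by simp
  then show ?thesis using t by simp
qed

text \<open>
The spectral reason is that \<open>star c * c\<close> and \<open>c * star c\<close> have the same nonzero spectrum. Instead
of spectra, growth of powers is compared here: \<open>z = t + c * star c\<close> and \<open>y = t + star c * c\<close>
satisfy \<open>z\<^sup>n c = c y\<^sup>n\<close>, so the norm of \<open>z\<^sup>n\<close> exceeds \<open>t\<^sup>n\<close> at most by a factor that is linear in \<open>n\<close>.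
For self-adjoint \<open>z\<close> and \<open>n = 2\<^sup>m\<close> that norm is the \<open>n\<close>-th power of the norm of \<open>z\<close>, so taking
\<open>n\<close>-th roots removes the factor.
\<close>
lemma uminus_star_mult_swap:
  assumes c: "- (star c * c) \<in> pos_cone"
  shows "- (c * star c) \<in> pos_cone"
proof -
  obtain t where t: "0 \<le> t" and le: "norm (t *\<^sub>R 1 + star c * c) \<le> t"
    using c by (auto simp: pos_cone_def)
  define z where "z = t *\<^sub>R 1 + c * star c"
  have sa: "star z = z" by (simp add: z_def star_add star_scaleR star_mult star_star)
  have "norm z \<le> t"
  proof (cases "t = 0")
    case True
    then have "star c * c = 0" using le by simp
    then have "c = 0" using cstar_identity[of c] by simp
    then show ?thesis using True by (simp add: z_def)
  next
    case False
    then have "t > 0" using t by simp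
    define y where "y = t *\<^sub>R 1 + star c * c"
    have zc: "z ^ n * c = c * y ^ n" for n
    proof (induction n)
      case (Suc n)
      have "z ^ Suc n * c = z * (c * y ^ n)" using Suc by (simp add: mult.assoc)
      also have "z * (c * y ^ n) = c * (y * y ^ n)" by (simp add: z_def y_def algebra_simps)
      finally show ?case by simp
    qed simp
    have yn: "norm (y ^ n) \<le> t ^ n" for n
      using norm_power_ineq[of y n] power_mono[of "norm y" t n] le by (simp add: y_def)
    define K where "K = (norm c)\<^sup>2 / t"
    have zn: "norm (z ^ n) \<le> t ^ n * (1 + real n * K)" for n
    proof (induction n)
      case (Suc n)
      have "z ^ Suc n = t *\<^sub>R z ^ n + (c * y ^ n) * star c"
        by (simp only: zc[symmetric] power_Suc2) (simp add: z_def algebra_simps)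
      then have "norm (z ^ Suc n) \<le> t * norm (z ^ n) + norm (c * y ^ n * star c)"
        using norm_triangle_ineq[of "t *\<^sub>R z ^ n" "c * y ^ n * star c"] t by simp
      also have "norm (c * y ^ n * star c) \<le> norm c * t ^ n * norm c"
        using norm_mult_ineq[of "c * y ^ n" "star c"] norm_mult_ineq[of c "y ^ n"]
          mult_left_mono[OF yn[of n] norm_ge_zero[of c]]
        by (smt (verit) mult_right_mono norm_ge_zero norm_star)
      also have "norm c * t ^ n * norm c = t ^ Suc n * K"
        using \<open>t > 0\<close> by (simp add: K_def power2_eq_square)
      also have "t * norm (z ^ n) \<le> t * (t ^ n * (1 + real n * K))"
        using Suc t by (rule mult_left_mono)
      finally show ?case by (simp add: algebra_simps)
    qed simp
    show ?thesis
    proof (rule ccontr)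
      assume "\<not> norm z \<le> t"
      then have big: "t < norm z" by simp
      define x where "x = t / norm z"
      have x: "0 < x" "x < 1" using big \<open>t > 0\<close> less_trans[OF \<open>t > 0\<close> big] by (simp_all add: x_def del: zero_less_norm_iff)
      have "1 \<le> x ^ (2 ^ m) + real (2 ^ m) * x ^ (2 ^ m) * K" for m :: nat
      proof -
        have "norm z ^ (2 ^ m) \<le> t ^ (2 ^ m) * (1 + real (2 ^ m) * K)"
          using zn[of "2 ^ m"] by (simp add: norm_power_selfadjoint[OF sa])
        then have "1 \<le> x ^ (2 ^ m) * (1 + real (2 ^ m) * K)"
          using less_trans[OF \<open>t > 0\<close> big]
          by (simp add: x_def power_divide pos_le_divide_eq del: zero_less_norm_iff)
        then show ?thesis by (simp add: algebra_simps)
      qed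
      moreover have "(\<lambda>n. x ^ n + real n * x ^ n * K) \<longlonglongrightarrow> 0 + 0 * K"
        using x by (intro tendsto_intros LIMSEQ_power_zero powser_times_n_limit_0) auto
      then have "((\<lambda>n. x ^ n + real n * x ^ n * K) \<circ> (\<lambda>m. 2 ^ m)) \<longlonglongrightarrow> 0 + 0 * K"
        by (rule LIMSEQ_subseq_LIMSEQ) (simp add: strict_mono_def)
      ultimately have "1 \<le> 0 + 0 * K"
        by (intro LIMSEQ_le_const) (auto simp: o_def)
      then show False by simp
    qed
  qed
  then show ?thesis
    using t by (auto simp: pos_cone_def z_def star_minus star_mult star_star intro!: exI[of _ t])
qed

text \<open>
Put \<open>x = star b * b\<close> and \<open>e = \<bar>x\<bar>\<close>, the square root of \<open>x\<^sup>2\<close>. Then \<open>v = e - x\<close> is twice the negative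
part of \<open>x\<close>, and it has to be shown that \<open>v = 0\<close>. The element \<open>c = b v\<close> satisfies
\<open>star c * c = v x v = - e v\<^sup>2\<close>, which is the negative of a square. By the preceding lemma
\<open>- (c * star c)\<close> is positive too. But \<open>star c * c + c * star c\<close> is a positive multiple of the sum of
the squares of the real and the imaginary part of \<open>c\<close>, so that \<open>star c * c\<close> is positive as well as
negative. Hence it vanishes, and \<open>v = 0\<close> follows.
\<close>
theorem star_mult_in_pos_cone: "star b * b \<in> pos_cone"
proof -
  define x where "x = star b * b"
  have sx: "star x = x" by (simp add: x_def star_mult star_star)
  obtain e where e: "e \<in> pos_cone" "e * e = x * x" "x * e = e * x"
    using pos_cone_sqrt[OF square_in_pos_cone[OF sx]] by (metis mult.assoc)
  then have se: "star e = e" by (simp add: pos_cone_def)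
  obtain s where s: "s \<in> pos_cone" "s * s = e" "x * s = s * x" "e * s = s * e"
    using pos_cone_sqrt[OF e(1)] e(3) by (metis mult.assoc)
  then have ss: "star s = s" by (simp add: pos_cone_def)
  define v where "v = e - x"
  have sv: "star v = v" by (simp add: v_def star_diff se sx)
  have comm: "s * v = v * s" using s by (simp add: v_def algebra_simps)
  have xv: "x * v = - (e * v)" using e by (simp add: v_def algebra_simps)
  \<comment> \<open>The square root \<open>s\<close> of \<open>e\<close> turns \<open>e v\<^sup>2\<close> into the square of the self-adjoint \<open>s v\<close>.\<close>
  define q where "q = s * v"
  have sq: "star q = q" by (simp add: q_def star_mult sv ss comm)
  define c where "c = b * v"
  have "star c * c = v * (x * v)" by (simp add: c_def x_def star_mult sv mult.assoc)
  also have "\<dots> = - (q * q)"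
    unfolding xv s(2)[symmetric] q_def using comm by (metis mult.assoc mult_minus_right)
  finally have cc: "star c * c = - (q * q)" .
  have neg: "- (star c * c) \<in> pos_cone" unfolding cc using square_in_pos_cone[OF sq] by simp
  \<comment> \<open>Twice the real part of \<open>c\<close>, and minus twice its imaginary part.\<close>
  define p1 where "p1 = c + star c"
  define p2 where "p2 = \<i> *\<^sub>C (c - star c)"
  have "star p1 = p1" by (simp add: p1_def star_add star_star)
  moreover have "star p2 = p2"
    by (simp add: p2_def star_scaleC star_diff star_star complex_vector.scale_minus_left
        complex_vector.scale_right_diff_distrib)
  ultimately have "(1/2) *\<^sub>R (p1 * p1 + p2 * p2) \<in> pos_cone"
    by (intro pos_cone_scaleR pos_cone_add square_in_pos_cone) auto
  moreover have "p1 * p1 + p2 * p2 = 2 *\<^sub>R (star c * c + c * star c)"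
    by (simp add: p1_def p2_def mult_scaleC_left mult_scaleC_right scaleC_scaleC
        complex_vector.scale_minus_left scaleC_one algebra_simps scaleR_2)
  ultimately have "star c * c + c * star c \<in> pos_cone" by simp
  then have "star c * c + c * star c + - (c * star c) \<in> pos_cone"
    using uminus_star_mult_swap[OF neg] by (rule pos_cone_add)
  then have "star c * c = 0" using neg by (intro pos_cone_antisym) simp_all
  then have "q = 0" using cc norm_square_selfadjoint[OF sq] by simp
  then have "e * v = 0" using s(2) by (metis q_def mult.assoc mult_zero_right)
  then have "v * v = 0" using xv by (simp add: v_def left_diff_distrib)
  then have "v = 0" using norm_square_selfadjoint[OF sv] by simp
  then show ?thesis using e(1) by (simp add: v_def x_def)
qed

definition cstate :: "('a::{cstar_algebra, real_normed_algebra_1} \<Rightarrow> complex) \<Rightarrow> bool"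
  where "cstate f \<longleftrightarrow> f 1 = 1 \<and> (\<forall>a b. f (a + b) = f a + f b) \<and> (\<forall>c a. f (c *\<^sub>C a) = c * f a) \<and>
    (\<forall>a. f (star a) = cnj (f a)) \<and> (\<forall>a. 0 \<le> Re (f (star a * a)))"

text \<open>
A real functional \<open>g\<close> of norm 1 that is norming at \<open>1 + p\<close>, where \<open>p = star b * b\<close>, is norming at both
\<open>1\<close> and \<open>p\<close>, because \<open>norm (1 + p) = 1 + norm p\<close>. From \<open>g 1 = 1\<close> and \<open>g \<le> norm\<close> it follows that
\<open>g\<close> is nonnegative on the cone. The state is the complex-linear extension of the
restriction of \<open>g\<close> to the self-adjoint elements.
\<close>
theorem norming_state:
  fixes b :: "'a::{cstar_algebra, real_normed_algebra_1}"
  obtains f where "cstate f" and "f (star b * b) = norm (star b * b)"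
proof -
  let ?p = "star b * b"
  obtain g :: "'a \<Rightarrow> real" where g: "linear g" "\<And>x. g x \<le> norm x" "g (1 + ?p) = norm (1 + ?p)"
    using norming_functional[of "1 + ?p"] by blast
  have "norm (1 + ?p) = 1 + norm ?p"
    using norm_add_pos_cone[OF star_mult_in_pos_cone[of b], of 1] by simp
  then have "g 1 + g ?p = 1 + norm ?p"
    using g(3) by (simp add: linear_add[OF g(1)])
  then have g1: "g 1 = 1" and gp: "g ?p = norm ?p"
    using g(2)[of 1] g(2)[of ?p] by simp_all
  have gpos: "0 \<le> g w" if "w \<in> pos_cone" for w
  proof -
    obtain t where "norm (t *\<^sub>R 1 - w) \<le> t" using \<open>w \<in> pos_cone\<close> by (auto simp: pos_cone_def)
    moreover have "g (t *\<^sub>R 1 - w) = t - g w"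
      by (simp add: linear_diff[OF g(1)] linear_scale[OF g(1)] g1)
    ultimately show ?thesis using g(2)[of "t *\<^sub>R 1 - w"] by simp
  qed
  define re where "re x = (1/2) *\<^sub>R (x + star x)" for x :: 'a
  define im where "im x = (1/2) *\<^sub>R ((- \<i>) *\<^sub>C (x - star x))" for x :: 'a
  define f where "f x = Complex (g (re x)) (g (im x))" for x
  have g0: "g 0 = 0" using linear_0[OF g(1)] .
  have fsa: "f x = of_real (g x)" if "star x = x" for x
    by (simp add: f_def re_def im_def \<open>star x = x\<close> g0 complex_eq_iff)
  have add: "f (x + y) = f x + f y" for x y
  proof -
    have "re (x + y) = re x + re y" "im (x + y) = im x + im y"
      by (simp_all add: re_def im_def star_add scaleR_right_distrib[symmetric] scaleC_add_right[symmetric])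
        (simp_all add: algebra_simps)
    then show ?thesis by (simp add: f_def linear_add[OF g(1)] complex_eq_iff)
  qed
  have real: "f (r *\<^sub>R x) = of_real r * f x" for r x
  proof -
    have "re (r *\<^sub>R x) = r *\<^sub>R re x" "im (r *\<^sub>R x) = r *\<^sub>R im x"
      by (simp_all add: re_def im_def star_scaleC scaleR_scaleC scaleC_scaleC mult.commute
        complex_vector.scale_right_diff_distrib scaleC_add_right)
    then show ?thesis by (simp add: f_def linear_scale[OF g(1)] complex_eq_iff)
  qed
  have imag: "f (\<i> *\<^sub>C x) = \<i> * f x" for x
  proof -
    have "re (\<i> *\<^sub>C x) = - im x" "im (\<i> *\<^sub>C x) = re x"
      by (simp_all add: re_def im_def star_scaleC scaleC_scaleC complex_vector.scale_minus_left
        complex_vector.scale_right_diff_distrib scaleC_add_right scaleC_one algebra_simps)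
    then show ?thesis by (simp add: f_def linear_neg[OF g(1)] complex_eq_iff)
  qed
  have scale: "f (c *\<^sub>C x) = c * f x" for c x
  proof -
    have c: "complex_of_real (Re c) + complex_of_real (Im c) * \<i> = c"
      by (simp add: complex_eq_iff)
    have "c *\<^sub>C x = (complex_of_real (Re c) + complex_of_real (Im c) * \<i>) *\<^sub>C x"
      by (simp only: c)
    also have "\<dots> = Re c *\<^sub>R x + Im c *\<^sub>R (\<i> *\<^sub>C x)"
      by (simp add: scaleC_add_left scaleR_scaleC scaleC_scaleC)
    finally have "f (c *\<^sub>C x) = (of_real (Re c) + of_real (Im c) * \<i>) * f x"
      by (simp add: add real imag algebra_simps)
    then show ?thesis by (simp only: c)
  qed
  have star: "f (star x) = cnj (f x)" for x
  proof -
    have "re (star x) = re x" "im (star x) = - im x"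
      by (simp_all add: re_def im_def star_star add.commute complex_vector.scale_minus_left
        complex_vector.scale_right_diff_distrib algebra_simps)
    then show ?thesis by (simp add: f_def linear_neg[OF g(1)] complex_eq_iff)
  qed
  have sq: "f (star x * x) = of_real (g (star x * x))" for x
    by (rule fsa) (simp add: star_mult star_star)
  have "cstate f"
    unfolding cstate_def
    using add scale star gpos[OF star_mult_in_pos_cone] fsa[of 1] g1 by (simp add: sq)
  then show ?thesis using that gp by (simp add: sq)
qed

section \<open>The unitization of a \<open>C\<^sup>*\<close>-algebra\<close>

datatype 'a unitization = Unitize (alg_part: 'a) (scalar_part: complex)

instantiation unitization :: (cstar_algebra) complex_vector
begin
definition "0 = Unitize 0 0"
definition "p + q = Unitize (alg_part p + alg_part q) (scalar_part p + scalar_part q)"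
definition "p - q = Unitize (alg_part p - alg_part q) (scalar_part p - scalar_part q)"
definition "- p = Unitize (- alg_part p) (- scalar_part p)"
definition "c *\<^sub>C p = Unitize (c *\<^sub>C alg_part p) (c * scalar_part p)"
instance
  by standard
    (simp_all add: zero_unitization_def plus_unitization_def minus_unitization_def
      uminus_unitization_def scaleC_unitization_def algebra_simps
      scaleC_add_right scaleC_add_left scaleC_scaleC scaleC_one)
end

instantiation unitization :: (cstar_algebra) real_algebra_1
begin
definition "1 = Unitize 0 1"
definition "p * q =
  Unitize (alg_part p * alg_part q + scalar_part p *\<^sub>C alg_part q + scalar_part q *\<^sub>C alg_part p)
    (scalar_part p * scalar_part q)"
definition "r *\<^sub>R (p :: 'a unitization) = complex_of_real r *\<^sub>C p"
instance
  by standard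
    (simp_all add: zero_unitization_def one_unitization_def plus_unitization_def
      times_unitization_def scaleC_unitization_def scaleR_unitization_def algebra_simps
      scaleC_add_right scaleC_add_left scaleC_scaleC scaleC_one mult_scaleC_left mult_scaleC_right)
end

lemma unitization_part_simps [simp]:
  fixes p q :: "'a::cstar_algebra unitization"
  shows "alg_part 0 = (0::'a)" "scalar_part (0::'a unitization) = 0"
    "alg_part 1 = (0::'a)" "scalar_part (1::'a unitization) = 1"
    "alg_part (p + q) = alg_part p + alg_part q"
    "scalar_part (p + q) = scalar_part p + scalar_part q"
    "alg_part (p - q) = alg_part p - alg_part q"
    "scalar_part (p - q) = scalar_part p - scalar_part q"
    "alg_part (- p) = - alg_part p" "scalar_part (- p) = - scalar_part p"
    "alg_part (c *\<^sub>C p) = c *\<^sub>C alg_part p" "scalar_part (c *\<^sub>C p) = c * scalar_part p"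
    "scalar_part (p * q) = scalar_part p * scalar_part q"
    "alg_part (p * q) = alg_part p * alg_part q + scalar_part p *\<^sub>C alg_part q + scalar_part q *\<^sub>C alg_part p"
  by (simp_all add: zero_unitization_def one_unitization_def plus_unitization_def
      minus_unitization_def uminus_unitization_def times_unitization_def scaleC_unitization_def)

definition left_mult :: "'a::cstar_algebra unitization \<Rightarrow> 'a \<Rightarrow> 'a"
  where "left_mult p b = alg_part p * b + scalar_part p *\<^sub>C b"

lemma bounded_linear_left_mult: "bounded_linear (left_mult p)"
proof (rule bounded_linear_intro[where K = "norm (alg_part p) + cmod (scalar_part p)"])
  show "norm (left_mult p x) \<le> norm x * (norm (alg_part p) + cmod (scalar_part p))" for x
    unfolding left_mult_def
    using norm_triangle_ineq[of "alg_part p * x" "scalar_part p *\<^sub>C x"]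
      norm_mult_ineq[of "alg_part p" x]
    by (simp add: norm_scaleC algebra_simps)
qed (simp_all add: left_mult_def scaleR_scaleC algebra_simps scaleC_add_right scaleC_scaleC mult_scaleC_right)

lemma norm_left_mult_le: "norm (left_mult p b) \<le> onorm (left_mult p) * norm b"
  by (rule onorm[OF bounded_linear_left_mult])

lemma onorm_left_mult_nonneg: "0 \<le> onorm (left_mult p)"
  by (rule onorm_pos_le[OF bounded_linear_left_mult])

lemma onorm_left_mult_Unitize: "onorm (left_mult (Unitize a 0)) = norm a"
proof (rule antisym)
  show "onorm (left_mult (Unitize a 0)) \<le> norm a"
    by (rule onorm_bound) (simp_all add: left_mult_def norm_mult_ineq)
  have "norm a * norm a \<le> onorm (left_mult (Unitize a 0)) * norm a"
    using norm_left_mult_le[of "Unitize a 0" "star a"]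
    by (simp add: left_mult_def norm_mult_star power2_eq_square)
  then show "norm a \<le> onorm (left_mult (Unitize a 0))"
    using onorm_left_mult_nonneg by (cases "a = 0") auto
qed

lemma onorm_left_mult_add: "onorm (left_mult (p + q)) \<le> onorm (left_mult p) + onorm (left_mult q)"
proof -
  have "left_mult (p + q) = (\<lambda>b. left_mult p b + left_mult q b)"
    by (simp add: left_mult_def fun_eq_iff algebra_simps scaleC_add_left)
  then show ?thesis
    by (simp add: onorm_triangle bounded_linear_left_mult)
qed

lemma left_mult_mult: "left_mult (p * q) b = left_mult p (left_mult q b)"
  by (simp add: left_mult_def algebra_simps scaleC_add_right scaleC_scaleC
      mult_scaleC_left mult_scaleC_right)

lemma onorm_left_mult_mult: "onorm (left_mult (p * q)) \<le> onorm (left_mult p) * onorm (left_mult q)"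
proof -
  have "left_mult (p * q) = left_mult p \<circ> left_mult q"
    by (simp add: fun_eq_iff left_mult_mult)
  then show ?thesis
    by (simp add: onorm_compose bounded_linear_left_mult)
qed

lemma onorm_left_mult_scaleC: "onorm (left_mult (c *\<^sub>C p)) = cmod c * onorm (left_mult p)"
proof -
  have le: "onorm (left_mult (c *\<^sub>C p)) \<le> cmod c * onorm (left_mult p)" for c and p :: "'a unitization"
  proof (rule onorm_bound)
    fix b
    have "left_mult (c *\<^sub>C p) b = c *\<^sub>C left_mult p b"
      by (simp add: left_mult_def scaleC_add_right scaleC_scaleC mult_scaleC_left)
    then show "norm (left_mult (c *\<^sub>C p) b) \<le> cmod c * onorm (left_mult p) * norm b"
      by (simp add: norm_scaleC mult.assoc mult_left_mono norm_left_mult_le)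
  qed (simp add: onorm_left_mult_nonneg)
  show ?thesis
  proof (cases "c = 0")
    case True
    then show ?thesis using le[of 0 p] onorm_left_mult_nonneg[of "0 *\<^sub>C p"] by simp
  next
    case False
    then have "onorm (left_mult p) \<le> cmod (inverse c) * onorm (left_mult (c *\<^sub>C p))"
      using le[of "inverse c" "c *\<^sub>C p"] by (simp add: scaleC_scaleC scaleC_one)
    then have "cmod c * onorm (left_mult p) \<le> onorm (left_mult (c *\<^sub>C p))"
      using False by (simp add: norm_divide field_simps)
    then show ?thesis using le[of c p] by simp
  qed
qed

text \<open>
If the algebra already has a unit \<open>e\<close>, then the operator norm of left multiplication vanishes at
\<open>1 - e\<close> and is only a seminorm on the unitization. Taking the maximum with the modulus of the
scalar part, which is a character, restores definiteness and preserves the \<open>C\<^sup>*\<close>-identity. This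
treats algebras with and without unit alike, and the zero algebra too.
\<close>
instantiation unitization :: (cstar_algebra) real_normed_algebra_1
begin
definition "norm p = max (cmod (scalar_part p)) (onorm (left_mult p))"
definition "sgn (p :: 'a unitization) = inverse (norm p) *\<^sub>R p"
definition "dist (p :: 'a unitization) q = norm (p - q)"
definition uniformity_unitization :: "('a unitization \<times> 'a unitization) filter"
  where "uniformity_unitization = (INF e\<in>{0<..}. principal {(x, y). dist x y < e})"
definition open_unitization :: "'a unitization set \<Rightarrow> bool"
  where "open_unitization S \<longleftrightarrow> (\<forall>x\<in>S. \<forall>\<^sub>F (x', y) in uniformity. x' = x \<longrightarrow> y \<in> S)"
instance
proof
  fix p q :: "'a unitization" and r :: real
  show "norm (p + q) \<le> norm p + norm q"
    using onorm_left_mult_add[of p q] norm_triangle_ineq[of "scalar_part p" "scalar_part q"]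
    by (simp add: norm_unitization_def max_def)
  show "norm (p * q) \<le> norm p * norm q"
  proof -
    have "cmod (scalar_part p) * cmod (scalar_part q) \<le> norm p * norm q"
      "onorm (left_mult p) * onorm (left_mult q) \<le> norm p * norm q"
      unfolding norm_unitization_def
      by (intro mult_mono; simp add: onorm_left_mult_nonneg le_max_iff_disj)+
    then show ?thesis
      using onorm_left_mult_mult[of p q] by (simp add: norm_unitization_def norm_mult)
  qed
  show "norm (r *\<^sub>R p) = \<bar>r\<bar> * norm p"
    by (simp add: norm_unitization_def scaleR_unitization_def onorm_left_mult_scaleC norm_mult
        max_mult_distrib_left)
  show "norm p = 0 \<longleftrightarrow> p = 0"
  proof
    assume "norm p = 0"
    then have "cmod (scalar_part p) \<le> 0" and L: "onorm (left_mult p) \<le> 0"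
      unfolding norm_unitization_def by (metis max.cobounded1, metis max.cobounded2)
    then have s: "scalar_part p = 0" by simp
    then have "norm (alg_part p) \<le> 0"
      using L onorm_left_mult_Unitize[of "alg_part p"] by (metis unitization.collapse)
    with s show "p = 0" by (auto intro: unitization.expand)
  next
    assume "p = 0"
    then show "norm p = 0"
      using onorm_left_mult_Unitize[of "0::'a"] by (simp add: norm_unitization_def zero_unitization_def)
  qed
  have "onorm (left_mult (1::'a unitization)) \<le> 1"
    by (rule onorm_bound) (simp_all add: left_mult_def scaleC_one)
  then show "norm (1::'a unitization) = 1"
    by (simp add: norm_unitization_def)
qed (simp_all add: sgn_unitization_def dist_unitization_def uniformity_unitization_def open_unitization_def)
end

lemma norm_Unitize [simp]: "norm (Unitize a 0) = norm a"
  by (simp add: norm_unitization_def onorm_left_mult_Unitize)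

lemma cmod_scalar_part_le: "cmod (scalar_part p) \<le> norm p"
  by (simp add: norm_unitization_def)

lemma unitization_decompose: "p = Unitize (alg_part p) 0 + scalar_part p *\<^sub>C 1"
  by (rule unitization.expand) simp

lemma norm_scaleC_unitization: "norm (c *\<^sub>C (p::'a::cstar_algebra unitization)) = cmod c * norm p"
  by (simp add: norm_unitization_def onorm_left_mult_scaleC norm_mult max_mult_distrib_left)

lemma norm_alg_part_le: "norm (alg_part p) \<le> 2 * norm p"
proof -
  have "Unitize (alg_part p) 0 = p - scalar_part p *\<^sub>C 1"
    using unitization_decompose[of p] by (simp add: algebra_simps)
  then have "norm (alg_part p) \<le> norm p + cmod (scalar_part p)"
    using norm_triangle_ineq4[of p "scalar_part p *\<^sub>C 1"] norm_Unitize[of "alg_part p"]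
    by (simp add: norm_scaleC_unitization)
  then show ?thesis using cmod_scalar_part_le[of p] by linarith
qed

lemma norm_unitization_le: "norm (p::'a::cstar_algebra unitization) \<le> norm (alg_part p) + cmod (scalar_part p)"
proof -
  have "norm p = norm (Unitize (alg_part p) 0 + scalar_part p *\<^sub>C 1)"
    by (rule arg_cong[OF unitization_decompose])
  also have "\<dots> \<le> norm (Unitize (alg_part p) 0) + norm (scalar_part p *\<^sub>C (1::'a unitization))"
    by (rule norm_triangle_ineq)
  finally show ?thesis by (simp add: norm_scaleC_unitization)
qed

instance unitization :: (cstar_algebra) banach
proof
  fix X :: "nat \<Rightarrow> 'a unitization" assume X: "Cauchy X"
  have "Cauchy (\<lambda>n. scalar_part (X n))"
  proof (rule metric_CauchyI)
    fix e :: real assume "e > 0"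
    then obtain M where "\<forall>m\<ge>M. \<forall>n\<ge>M. dist (X m) (X n) < e" using X metric_CauchyD by blast
    then show "\<exists>M. \<forall>m\<ge>M. \<forall>n\<ge>M. dist (scalar_part (X m)) (scalar_part (X n)) < e"
      using order_le_less_trans[OF cmod_scalar_part_le[of "X _ - X _"]]
      by (auto simp: dist_norm intro!: exI[of _ M])
  qed
  moreover have "Cauchy (\<lambda>n. alg_part (X n))"
  proof (rule metric_CauchyI)
    fix e :: real assume "e > 0"
    then obtain M where M: "\<forall>m\<ge>M. \<forall>n\<ge>M. dist (X m) (X n) < e / 2" using X metric_CauchyD[of X "e/2"] by auto
    have "dist (alg_part (X m)) (alg_part (X n)) < e" if "m \<ge> M" "n \<ge> M" for m n
      using M that norm_alg_part_le[of "X m - X n"] by (force simp: dist_norm)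
    then show "\<exists>M. \<forall>m\<ge>M. \<forall>n\<ge>M. dist (alg_part (X m)) (alg_part (X n)) < e" by blast
  qed
  ultimately obtain a l where al: "(\<lambda>n. alg_part (X n)) \<longlonglongrightarrow> a" "(\<lambda>n. scalar_part (X n)) \<longlonglongrightarrow> l"
    by (auto simp: Cauchy_convergent_iff convergent_def)
  have "(\<lambda>n. norm (alg_part (X n) - a) + cmod (scalar_part (X n) - l)) \<longlonglongrightarrow> norm (a - a) + cmod (l - l)"
    by (intro tendsto_intros al)
  then have lim: "(\<lambda>n. norm (alg_part (X n) - a) + cmod (scalar_part (X n) - l)) \<longlonglongrightarrow> 0" by simp
  have "norm (X n - Unitize a l) \<le> norm (alg_part (X n) - a) + cmod (scalar_part (X n) - l)" for n
    using norm_unitization_le[of "X n - Unitize a l"] by simp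
  then have "(\<lambda>n. X n - Unitize a l) \<longlonglongrightarrow> 0"
    by (intro Lim_null_comparison[OF _ lim] always_eventually) blast
  then show "convergent X"
    unfolding convergent_def using LIM_zero_cancel by blast
qed

instantiation unitization :: (cstar_algebra) cstar_algebra
begin
definition "star p = Unitize (star (alg_part p)) (cnj (scalar_part p))"
instance
proof
  fix p q :: "'a unitization" and c :: complex and r :: real
  show "r *\<^sub>R p = complex_of_real r *\<^sub>C p" by (simp add: scaleR_unitization_def)
  show "norm (c *\<^sub>C p) = cmod c * norm p" by (rule norm_scaleC_unitization)
  show "(c *\<^sub>C p) * q = c *\<^sub>C (p * q)" "p * (c *\<^sub>C q) = c *\<^sub>C (p * q)"
    by (rule unitization.expand,
        simp add: algebra_simps mult_scaleC_left mult_scaleC_right scaleC_add_right scaleC_scaleC)+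
  show "star (star p) = p" by (rule unitization.expand) (simp add: star_unitization_def star_star)
  show "star (p + q) = star p + star q"
    by (rule unitization.expand) (simp add: star_unitization_def star_add)
  show "star (c *\<^sub>C p) = cnj c *\<^sub>C star p"
    by (rule unitization.expand) (simp add: star_unitization_def star_scaleC)
  have anti: "star (p * q) = star q * star p" for p q :: "'a unitization"
    by (rule unitization.expand)
      (simp add: star_unitization_def star_add star_mult star_scaleC algebra_simps)
  then show "star (p * q) = star q * star p" .
  let ?K = "\<lambda>p :: 'a unitization. onorm (left_mult p)"
  \<comment> \<open>The \<open>C\<^sup>*\<close>-identity of the operator norm comes from that of the algebra, applied to \<open>p b\<close>.\<close>
  have sq: "(?K p)\<^sup>2 \<le> ?K (star p * p)" for p :: "'a unitization"
  proof -
    have "?K p \<le> sqrt (?K (star p * p))"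
    proof (rule onorm_bound)
      fix b
      have "star (left_mult p b) * left_mult p b = star b * left_mult (star p * p) b"
        by (simp add: left_mult_def star_unitization_def star_add star_mult star_scaleC algebra_simps
            scaleC_add_right scaleC_add_left scaleC_scaleC mult_scaleC_left mult_scaleC_right)
      then have "(norm (left_mult p b))\<^sup>2 \<le> norm (star b) * norm (left_mult (star p * p) b)"
        by (metis cstar_identity norm_mult_ineq)
      also have "\<dots> \<le> norm b * (?K (star p * p) * norm b)"
        by (simp add: mult_left_mono norm_left_mult_le)
      also have "\<dots> = (sqrt (?K (star p * p)) * norm b)\<^sup>2"
        by (simp add: onorm_left_mult_nonneg power_mult_distrib) (simp add: power2_eq_square)
      finally show "norm (left_mult p b) \<le> sqrt (?K (star p * p)) * norm b"
        by (rule power2_le_imp_le) (simp add: onorm_left_mult_nonneg)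
    qed (simp add: onorm_left_mult_nonneg)
    then have "(?K p)\<^sup>2 \<le> (sqrt (?K (star p * p)))\<^sup>2"
      by (rule power_mono) (rule onorm_left_mult_nonneg)
    then show ?thesis by (simp add: onorm_left_mult_nonneg)
  qed
  have le: "?K p \<le> ?K (star p)" for p :: "'a unitization"
  proof (cases "?K p = 0")
    case False
    have "?K p * ?K p \<le> ?K (star p) * ?K p"
      using sq[of p] onorm_left_mult_mult[of "star p" p] by (simp add: power2_eq_square)
    then show ?thesis using False onorm_left_mult_nonneg[of p] by simp
  qed (simp add: onorm_left_mult_nonneg)
  have "?K (star p) = ?K p"
    using le[of p] le[of "star p"] by (simp add: star_unitization_def star_star)
  then have "?K (star p * p) = (?K p)\<^sup>2"
    using sq[of p] onorm_left_mult_mult[of "star p" p] by (simp add: power2_eq_square)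
  moreover have "cmod (scalar_part (star p * p)) = (cmod (scalar_part p))\<^sup>2"
    by (simp add: star_unitization_def norm_mult power2_eq_square)
  moreover have "max (x\<^sup>2) (y\<^sup>2) = (max x y)\<^sup>2" if "0 \<le> x" "0 \<le> y" for x y :: real
    using that power_mono[of x y 2] power_mono[of y x 2] by (cases "x \<le> y") (auto simp: max_def)
  ultimately show "norm (star p * p) = (norm p)\<^sup>2"
    unfolding norm_unitization_def using onorm_left_mult_nonneg[of p] by simp
qed
end

section \<open>Completion of a semi-inner product space\<close>

text \<open>
The form may be degenerate on \<open>D\<close>. The same locale serves for the space that is to be
completed, for its completion and for the forms that functionals induce on a module.
\<close>
locale semi_inner_space =
  fixes D :: "'d::complex_vector set" and B :: "'d \<Rightarrow> 'd \<Rightarrow> complex"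
  assumes subspace_D: "complex_vector.subspace D"
    and B_add_left: "\<lbrakk>x \<in> D; y \<in> D; z \<in> D\<rbrakk> \<Longrightarrow> B (x + y) z = B x z + B y z"
    and B_scaleC_left: "\<lbrakk>x \<in> D; y \<in> D\<rbrakk> \<Longrightarrow> B (c *\<^sub>C x) y = c * B x y"
    and B_cnj: "\<lbrakk>x \<in> D; y \<in> D\<rbrakk> \<Longrightarrow> cnj (B x y) = B y x"
    and B_nonneg: "x \<in> D \<Longrightarrow> 0 \<le> Re (B x x)"
begin

abbreviation N :: "'d \<Rightarrow> real" where "N \<equiv> inner_norm B"

lemma zero_in_D [simp]: "0 \<in> D"
  by (rule complex_vector.subspace_0[OF subspace_D])

lemma add_in_D [simp]: "x \<in> D \<Longrightarrow> y \<in> D \<Longrightarrow> x + y \<in> D"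
  by (rule complex_vector.subspace_add[OF subspace_D])

lemma scaleC_in_D [simp]: "x \<in> D \<Longrightarrow> c *\<^sub>C x \<in> D"
  by (rule complex_vector.subspace_scale[OF subspace_D])

lemma diff_in_D [simp]: "x \<in> D \<Longrightarrow> y \<in> D \<Longrightarrow> x - y \<in> D"
  by (rule complex_vector.subspace_diff[OF subspace_D])

lemma B_add_right: "\<lbrakk>x \<in> D; y \<in> D; z \<in> D\<rbrakk> \<Longrightarrow> B x (y + z) = B x y + B x z"
  using B_add_left[of y z x] by (metis B_cnj add_in_D complex_cnj_add)

lemma B_scaleC_right: "\<lbrakk>x \<in> D; y \<in> D\<rbrakk> \<Longrightarrow> B x (c *\<^sub>C y) = cnj c * B x y"
  using B_scaleC_left[of y x c] by (metis B_cnj scaleC_in_D complex_cnj_mult)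

lemma B_zero_right: "x \<in> D \<Longrightarrow> B x 0 = 0"
  using B_add_right[of x 0 0] by simp

lemma B_diff_left: "\<lbrakk>x \<in> D; y \<in> D; z \<in> D\<rbrakk> \<Longrightarrow> B (x - y) z = B x z - B y z"
  using B_add_left[of "x - y" y z] by simp

lemma B_diff_right: "\<lbrakk>x \<in> D; y \<in> D; z \<in> D\<rbrakk> \<Longrightarrow> B x (y - z) = B x y - B x z"
  using B_add_right[of x "y - z" z] by simp

lemma N_nonneg: "x \<in> D \<Longrightarrow> 0 \<le> N x"
  by (simp add: inner_norm_def B_nonneg)

lemma N_squared: "x \<in> D \<Longrightarrow> (N x)\<^sup>2 = Re (B x x)"
  by (simp add: inner_norm_def B_nonneg)

lemma B_self: "x \<in> D \<Longrightarrow> B x x = of_real (Re (B x x))"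
  using B_cnj[of x x] by (simp add: complex_eq_iff)

lemma Cauchy_Schwarz: 
  assumes x: "x \<in> D" and y: "y \<in> D"
  shows "cmod (B x y) \<le> N x * N y"
proof -
  define z where "z = B x y"
  have expand: "0 \<le> Re (B x x) - 2 * Re (cnj c * z) + (cmod c)\<^sup>2 * Re (B y y)" for c
  proof -
    have yx: "B y x = cnj z" using B_cnj[OF x y] by (simp add: z_def)
    have "B (x - c *\<^sub>C y) (x - c *\<^sub>C y) = B x x - cnj c * z - c * cnj z + c * cnj c * B y y"
      using x y by (simp add: B_diff_left B_diff_right B_scaleC_left B_scaleC_right yx z_def[symmetric] algebra_simps)
    then have "Re (B (x - c *\<^sub>C y) (x - c *\<^sub>C y)) = Re (B x x) - 2 * Re (cnj c * z) + (cmod c)\<^sup>2 * Re (B y y)"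
      by (simp add: complex_norm_square[symmetric] cmod_power2 power2_eq_square)
    then show ?thesis using B_nonneg[of "x - c *\<^sub>C y"] x y by simp
  qed
  have zz: "Re (cnj z * z) = (cmod z)\<^sup>2"
    unfolding cmod_power2 by (simp add: power2_eq_square)
  have "(cmod z)\<^sup>2 \<le> Re (B x x) * Re (B y y)"
  proof (cases "Re (B y y) = 0")
    case True
    have "cmod z = 0"
    proof (rule ccontr)
      assume nz: "cmod z \<noteq> 0"
      define t where "t = (Re (B x x) + 1) / (2 * (cmod z)\<^sup>2)"
      have "Re (cnj (of_real t * z) * z) = t * Re (cnj z * z)" by (simp add: algebra_simps)
      then have "2 * Re (cnj (of_real t * z) * z) = 2 * t * (cmod z)\<^sup>2"
        unfolding zz by simp
      also have "\<dots> = Re (B x x) + 1" using nz by (simp add: t_def)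
      finally show False using expand[of "of_real t * z"] True by simp
    qed
    then show ?thesis using True by simp
  next
    case False
    then have b: "Re (B y y) > 0" using B_nonneg[OF y] by simp
    define k where "k = inverse (Re (B y y))"
    have k: "k * Re (B y y) = 1" "k > 0" using b by (simp_all add: k_def)
    have "Re (cnj (of_real k * z) * z) = k * Re (cnj z * z)" by (simp add: algebra_simps)
    moreover have "(cmod (of_real k * z))\<^sup>2 * Re (B y y) = k * (cmod z)\<^sup>2 * (k * Re (B y y))"
      by (simp add: norm_mult power_mult_distrib power2_eq_square)
    ultimately have "k * (cmod z)\<^sup>2 \<le> Re (B x x)"
      using expand[of "of_real k * z"] unfolding zz k by simp
    then have "Re (B y y) * (k * (cmod z)\<^sup>2) \<le> Re (B y y) * Re (B x x)"
      using b by (intro mult_left_mono) auto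
    moreover have "Re (B y y) * (k * (cmod z)\<^sup>2) = (cmod z)\<^sup>2"
      using k(1) by (metis mult.assoc mult.commute mult.left_neutral)
    ultimately show ?thesis by (simp add: mult.commute)
  qed
  also have "\<dots> = (N x * N y)\<^sup>2" using x y by (simp add: power_mult_distrib N_squared)
  finally show ?thesis unfolding z_def
    by (rule power2_le_imp_le) (simp add: N_nonneg x y)
qed

lemma N_triangle:
  assumes x: "x \<in> D" and y: "y \<in> D"
  shows "N (x + y) \<le> N x + N y"
proof (rule power2_le_imp_le)
  have "Re (B x y) \<le> N x * N y"
    using Cauchy_Schwarz[OF x y] complex_Re_le_cmod[of "B x y"] by linarith
  moreover have "Re (B y x) = Re (B x y)" using B_cnj[OF x y] by (metis cnj.sel(1))
  ultimately have "Re (B (x + y) (x + y)) \<le> Re (B x x) + 2 * (N x * N y) + Re (B y y)"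
    using x y by (simp add: B_add_left B_add_right)
  then show "(N (x + y))\<^sup>2 \<le> (N x + N y)\<^sup>2"
    using x y by (simp add: N_squared power2_sum)
qed (simp add: N_nonneg x y)

lemma N_scaleC: "x \<in> D \<Longrightarrow> N (c *\<^sub>C x) = cmod c * N x"
proof -
  assume x: "x \<in> D"
  have "B (c *\<^sub>C x) (c *\<^sub>C x) = (c * cnj c) * B x x"
    using x by (simp add: B_scaleC_left B_scaleC_right)
  also have "c * cnj c = of_real ((cmod c)\<^sup>2)" by (rule complex_norm_square[symmetric])
  finally have "B (c *\<^sub>C x) (c *\<^sub>C x) = of_real ((cmod c)\<^sup>2) * B x x" .
  then have "Re (B (c *\<^sub>C x) (c *\<^sub>C x)) = (cmod c)\<^sup>2 * Re (B x x)"
    by simp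
  then show ?thesis by (simp add: inner_norm_def real_sqrt_mult)
qed

lemma N_zero [simp]: "N 0 = 0"
  using N_scaleC[of 0 0] by simp

lemma N_triangle_diff: "\<lbrakk>x \<in> D; y \<in> D; z \<in> D\<rbrakk> \<Longrightarrow> N (x - z) \<le> N (x - y) + N (y - z)"
  using N_triangle[of "x - y" "y - z"] by simp

definition N_Cauchy :: "(nat \<Rightarrow> 'd) \<Rightarrow> bool"
  where "N_Cauchy s \<longleftrightarrow> (\<forall>n. s n \<in> D) \<and> (\<forall>e>0. \<exists>M. \<forall>m\<ge>M. \<forall>n\<ge>M. N (s m - s n) < e)"

lemma N_Cauchy_in_D: "N_Cauchy s \<Longrightarrow> s n \<in> D"
  by (simp add: N_Cauchy_def)

lemma N_CauchyD:
  assumes "N_Cauchy s" "e > 0"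
  obtains M where "\<And>m n. m \<ge> M \<Longrightarrow> n \<ge> M \<Longrightarrow> N (s m - s n) < e"
  using assms unfolding N_Cauchy_def by blast

lemma N_Cauchy_const: "x \<in> D \<Longrightarrow> N_Cauchy (\<lambda>_. x)"
  by (simp add: N_Cauchy_def)

lemma N_Cauchy_add:
  assumes "N_Cauchy s" "N_Cauchy t"
  shows "N_Cauchy (\<lambda>n. s n + t n)"
  unfolding N_Cauchy_def
proof (intro conjI allI impI)
  fix e :: real assume "e > 0"
  then obtain M M' where M: "\<And>m n. m \<ge> M \<Longrightarrow> n \<ge> M \<Longrightarrow> N (s m - s n) < e/2"
    and M': "\<And>m n. m \<ge> M' \<Longrightarrow> n \<ge> M' \<Longrightarrow> N (t m - t n) < e/2"
    using N_CauchyD[OF assms(1), of "e/2"] N_CauchyD[OF assms(2), of "e/2"] by (metis half_gt_zero)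
  have "N (s m + t m - (s n + t n)) < e" if "m \<ge> max M M'" "n \<ge> max M M'" for m n
  proof -
    have eq: "s m + t m - (s n + t n) = (s m - s n) + (t m - t n)" by simp
    have "N (s m + t m - (s n + t n)) \<le> N (s m - s n) + N (t m - t n)"
      unfolding eq by (rule N_triangle) (use assms in \<open>simp_all add: N_Cauchy_in_D\<close>)
    then show ?thesis using M[of m n] M'[of m n] that by simp
  qed
  then show "\<exists>M. \<forall>m\<ge>M. \<forall>n\<ge>M. N (s m + t m - (s n + t n)) < e" by blast
qed (use assms in \<open>simp add: N_Cauchy_in_D\<close>)

lemma N_Cauchy_map:
  assumes s: "N_Cauchy s" and T: "\<And>x. x \<in> D \<Longrightarrow> T x \<in> D"
    and diff: "\<And>x y. x \<in> D \<Longrightarrow> y \<in> D \<Longrightarrow> T (x - y) = T x - T y"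
    and bound: "\<And>x. x \<in> D \<Longrightarrow> N (T x) \<le> K * N x"
  shows "N_Cauchy (\<lambda>n. T (s n))"
  unfolding N_Cauchy_def
proof (intro conjI allI impI)
  fix e :: real assume "e > 0"
  then have "e / (\<bar>K\<bar> + 1) > 0" by simp
  then obtain M where M: "\<And>m n. m \<ge> M \<Longrightarrow> n \<ge> M \<Longrightarrow> N (s m - s n) < e / (\<bar>K\<bar> + 1)"
    using N_CauchyD[OF s] by blast
  have "N (T (s m) - T (s n)) < e" if "m \<ge> M" "n \<ge> M" for m n
  proof -
    have in_D: "s m \<in> D" "s n \<in> D" using s by (simp_all add: N_Cauchy_in_D)
    have "N (T (s m) - T (s n)) \<le> K * N (s m - s n)"
      using bound[of "s m - s n"] diff[of "s m" "s n"] in_D by simp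
    also have "\<dots> \<le> (\<bar>K\<bar> + 1) * N (s m - s n)"
      using N_nonneg[of "s m - s n"] in_D by (intro mult_right_mono) auto
    also have "\<dots> < (\<bar>K\<bar> + 1) * (e / (\<bar>K\<bar> + 1))"
      using M[OF that] by (intro mult_strict_left_mono) auto
    finally show ?thesis by simp
  qed
  then show "\<exists>M. \<forall>m\<ge>M. \<forall>n\<ge>M. N (T (s m) - T (s n)) < e" by blast
qed (use s T in \<open>simp add: N_Cauchy_in_D\<close>)

lemma N_Cauchy_scaleC: "N_Cauchy s \<Longrightarrow> N_Cauchy (\<lambda>n. c *\<^sub>C s n)"
  by (rule N_Cauchy_map[where K = "cmod c"])
    (simp_all add: complex_vector.scale_right_diff_distrib N_scaleC)

lemma N_Cauchy_diff: "N_Cauchy s \<Longrightarrow> N_Cauchy t \<Longrightarrow> N_Cauchy (\<lambda>n. s n - t n)"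
  using N_Cauchy_add[OF _ N_Cauchy_scaleC[of t "-1"], of s]
  by (simp add: complex_vector.scale_minus_left scaleC_one)

lemma N_Cauchy_bounded:
  assumes "N_Cauchy s"
  obtains K where "K > 0" and "\<And>n. N (s n) \<le> K"
proof -
  obtain M where M: "\<And>m n. m \<ge> M \<Longrightarrow> n \<ge> M \<Longrightarrow> N (s m - s n) < 1"
    using N_CauchyD[OF assms, of 1] by auto
  define K where "K = 1 + (\<Sum>n\<le>M. N (s n))"
  have nn: "0 \<le> N (s n)" for n using assms by (simp add: N_nonneg N_Cauchy_in_D)
  have single: "N (s n) \<le> (\<Sum>n\<le>M. N (s n))" if "n \<le> M" for n
    using that nn by (intro member_le_sum) auto
  have "N (s n) \<le> K" for n
  proof (cases "n \<le> M")
    case True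
    then show ?thesis using single by (simp add: K_def add_increasing)
  next
    case False
    then have "N (s n - s M) < 1" using M[of n M] by simp
    moreover have "N (s n) \<le> N (s n - s M) + N (s M)"
      using N_triangle[of "s n - s M" "s M"] assms by (simp add: N_Cauchy_in_D)
    ultimately show ?thesis using single[of M] by (simp add: K_def)
  qed
  moreover have "K > 0" using sum_nonneg[of "{..M}" "\<lambda>n. N (s n)"] nn by (simp add: K_def add_pos_nonneg)
  ultimately show ?thesis using that by blast
qed

lemma B_null_Cauchy:
  assumes s: "\<And>n. s n \<in> D" and t: "N_Cauchy t" and null: "(\<lambda>n. N (s n)) \<longlonglongrightarrow> 0"
  shows "(\<lambda>n. B (s n) (t n)) \<longlonglongrightarrow> 0" and "(\<lambda>n. B (t n) (s n)) \<longlonglongrightarrow> 0"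
proof -
  obtain K where K: "K > 0" "\<And>n. N (t n) \<le> K" using N_Cauchy_bounded[OF t] by blast
  have lim: "(\<lambda>n. N (s n) * K) \<longlonglongrightarrow> 0"
    using tendsto_mult_right[OF null, of K] by simp
  have le: "cmod (B (s n) (t n)) \<le> N (s n) * K" for n
    using Cauchy_Schwarz[of "s n" "t n"] mult_left_mono[OF K(2)[of n] N_nonneg[of "s n"]] s N_Cauchy_in_D[OF t]
    by (meson order_trans)
  show *: "(\<lambda>n. B (s n) (t n)) \<longlonglongrightarrow> 0"
    using le by (intro Lim_null_comparison[OF _ lim] always_eventually) auto
  have "B (t n) (s n) = cnj (B (s n) (t n))" for n
    by (simp add: B_cnj s N_Cauchy_in_D[OF t])
  then show "(\<lambda>n. B (t n) (s n)) \<longlonglongrightarrow> 0"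
    using tendsto_cnj[OF *] by simp
qed

lemma B_convergent:
  assumes s: "N_Cauchy s" and t: "N_Cauchy t"
  shows "convergent (\<lambda>n. B (s n) (t n))"
proof -
  have "Cauchy (\<lambda>n. B (s n) (t n))"
  proof (rule metric_CauchyI)
    fix e :: real assume "e > 0"
    obtain K where K: "K > 0" "\<And>n. N (s n) \<le> K" using N_Cauchy_bounded[OF s] by blast
    obtain L where L: "L > 0" "\<And>n. N (t n) \<le> L" using N_Cauchy_bounded[OF t] by blast
    obtain M where M: "\<And>m n. m \<ge> M \<Longrightarrow> n \<ge> M \<Longrightarrow> N (s m - s n) < e / (2 * L)"
      using N_CauchyD[OF s, of "e / (2 * L)"] \<open>e > 0\<close> L(1) by auto
    obtain M' where M': "\<And>m n. m \<ge> M' \<Longrightarrow> n \<ge> M' \<Longrightarrow> N (t m - t n) < e / (2 * K)"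
      using N_CauchyD[OF t, of "e / (2 * K)"] \<open>e > 0\<close> K(1) by auto
    have "dist (B (s m) (t m)) (B (s n) (t n)) < e" if "m \<ge> max M M'" "n \<ge> max M M'" for m n
    proof -
      have D: "s m \<in> D" "s n \<in> D" "t m \<in> D" "t n \<in> D" using s t by (simp_all add: N_Cauchy_in_D)
      have "B (s m) (t m) - B (s n) (t n) = B (s m - s n) (t m) + B (s n) (t m - t n)"
        using D by (simp add: B_diff_left B_diff_right)
      then have "dist (B (s m) (t m)) (B (s n) (t n)) \<le> cmod (B (s m - s n) (t m)) + cmod (B (s n) (t m - t n))"
        by (simp add: dist_norm norm_triangle_ineq)
      also have "\<dots> \<le> N (s m - s n) * N (t m) + N (s n) * N (t m - t n)"
        using D by (intro add_mono Cauchy_Schwarz) auto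
      also have "\<dots> \<le> N (s m - s n) * L + K * N (t m - t n)"
        using D K L by (intro add_mono mult_left_mono mult_right_mono) (auto simp: N_nonneg)
      also have "\<dots> < e / (2 * L) * L + K * (e / (2 * K))"
        using M[of m n] M'[of m n] that K(1) L(1)
        by (intro add_strict_mono mult_strict_right_mono mult_strict_left_mono) auto
      also have "\<dots> = e" using K(1) L(1) by simp
      finally show ?thesis .
    qed
    then show "\<exists>M. \<forall>m\<ge>M. \<forall>n\<ge>M. dist (B (s m) (t m)) (B (s n) (t n)) < e" by blast
  qed
  then show ?thesis by (rule Cauchy_convergent)
qed

lemma Metric_space_N:
  assumes definite: "\<And>x. x \<in> D \<Longrightarrow> B x x = 0 \<Longrightarrow> x = 0"
    and outside: "\<And>x. x \<notin> D \<Longrightarrow> B x x = 0"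
  shows "Metric_space D (\<lambda>x y. N (x - y))"
proof
  fix x y z
  show "0 \<le> N (x - y)"
    using N_nonneg[of "x - y"] outside[of "x - y"] by (cases "x - y \<in> D") (simp_all add: inner_norm_def)
  show "N (x - y) = N (y - x)"
  proof (cases "x - y \<in> D")
    case True
    then show ?thesis using N_scaleC[of "x - y" "-1"] by (simp add: complex_vector.scale_minus_left scaleC_one)
  next
    case False
    moreover from this have "y - x \<notin> D" using scaleC_in_D[of "y - x" "-1"]
      by (auto simp: complex_vector.scale_minus_left scaleC_one)
    ultimately show ?thesis by (simp add: inner_norm_def outside)
  qed
  assume D: "x \<in> D" "y \<in> D"
  show "N (x - y) = 0 \<longleftrightarrow> x = y"
  proof
    assume "N (x - y) = 0"
    then have "B (x - y) (x - y) = 0" using D B_self[of "x - y"] N_squared[of "x - y"] by simp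
    then show "x = y" using D definite[of "x - y"] by simp
  qed simp
  assume "z \<in> D"
  then show "N (x - z) \<le> N (x - y) + N (y - z)"
    using D by (intro N_triangle_diff)
qed

end

text \<open>
Vectors of the completion are realized as functions: a vector \<open>v\<close> is represented by the family of
its inner products with the generators \<open>J f a\<close>. A Cauchy sequence then has the pointwise limit
of these families as its limit, and no quotient is needed. Two sequences with the same
pointwise limit are equivalent because the generators span \<open>D\<close>.
\<close>
locale generated_semi_inner_space = semi_inner_space D B
  for D :: "'d::complex_vector set" and B +
  fixes J :: "'f \<Rightarrow> 'a \<Rightarrow> 'd"
  assumes J_in_D: "J f a \<in> D"
    and D_subset_span: "D \<subseteq> complex_vector.span {J f a | f a. True}"
begin

definition represents :: "(nat \<Rightarrow> 'd) \<Rightarrow> ('f \<Rightarrow> 'a \<Rightarrow> complex) \<Rightarrow> bool"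
  where "represents s v \<longleftrightarrow> N_Cauchy s \<and> (\<forall>f a. (\<lambda>n. B (s n) (J f a)) \<longlonglongrightarrow> v f a)"

definition completion :: "('f \<Rightarrow> 'a \<Rightarrow> complex) set"
  where "completion = {v. \<exists>s. represents s v}"

definition embed :: "'d \<Rightarrow> 'f \<Rightarrow> 'a \<Rightarrow> complex"
  where "embed d f a = B d (J f a)"

definition rep_seq :: "('f \<Rightarrow> 'a \<Rightarrow> complex) \<Rightarrow> nat \<Rightarrow> 'd"
  where "rep_seq v = (SOME s. represents s v)"

text \<open>
The value \<open>0\<close> outside the completion makes the induced distance symmetric and nonnegative on the
whole function space, as the metric space locale demands.
\<close>
definition completion_ip :: "('f \<Rightarrow> 'a \<Rightarrow> complex) \<Rightarrow> ('f \<Rightarrow> 'a \<Rightarrow> complex) \<Rightarrow> complex"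
  where "completion_ip v w =
    (if v \<in> completion \<and> w \<in> completion then lim (\<lambda>n. B (rep_seq v n) (rep_seq w n)) else 0)"

lemma represents_Cauchy: "represents s v \<Longrightarrow> N_Cauchy s"
  by (simp add: represents_def)

lemma represents_in_D: "represents s v \<Longrightarrow> s n \<in> D"
  by (simp add: represents_def N_Cauchy_in_D)

lemma represents_unique:
  assumes "represents s v" "represents s w"
  shows "v = w"
  using assms LIMSEQ_unique unfolding represents_def by (intro ext) blast

lemma represents_rep_seq: "v \<in> completion \<Longrightarrow> represents (rep_seq v) v"
  unfolding completion_def rep_seq_def by (auto intro: someI[of "\<lambda>s. represents s v"])

lemma represents_in_completion: "represents s v \<Longrightarrow> v \<in> completion"
  by (auto simp: completion_def)

lemma represents_embed: "d \<in> D \<Longrightarrow> represents (\<lambda>_. d) (embed d)"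
  by (simp add: represents_def N_Cauchy_const embed_def)

lemma represents_add:
  assumes "represents s v" "represents t w"
  shows "represents (\<lambda>n. s n + t n) (v + w)"
  using assms
  by (auto simp: represents_def N_Cauchy_add B_add_left N_Cauchy_in_D J_in_D intro!: tendsto_add)

lemma represents_diff:
  assumes "represents s v" "represents t w"
  shows "represents (\<lambda>n. s n - t n) (v - w)"
  using assms
  by (auto simp: represents_def N_Cauchy_diff B_diff_left N_Cauchy_in_D J_in_D intro!: tendsto_diff)

lemma represents_scaleC:
  assumes "represents s v"
  shows "represents (\<lambda>n. c *\<^sub>C s n) (c *\<^sub>C v)"
  using assms
  by (auto simp: represents_def N_Cauchy_scaleC B_scaleC_left N_Cauchy_in_D J_in_D scaleC_fun_def
      scaleC_complex_def intro!: tendsto_mult_left)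

text \<open>
A Cauchy sequence that converges weakly to zero converges to zero in norm, by
\<open>B (s n) (s n) = B (s n) (s n - s M) + B (s n) (s M)\<close>: for large \<open>M\<close> the first term is uniformly
small, and for fixed \<open>M\<close> the second one tends to zero. This is what makes the inner product
of the completion independent of the representing sequences.
\<close>
lemma represents_zero_imp_null:
  assumes s: "represents s 0"
  shows "(\<lambda>n. N (s n)) \<longlonglongrightarrow> 0"
proof -
  have C: "N_Cauchy s" and D: "\<And>n. s n \<in> D" using s by (auto simp: represents_def N_Cauchy_def)
  have weak: "(\<lambda>n. B (s n) d) \<longlonglongrightarrow> 0" if "d \<in> D" for d
  proof -
    have "d \<in> complex_vector.span {J f a | f a. True}" using that D_subset_span by blast
    then have "d \<in> D \<and> (\<lambda>n. B (s n) d) \<longlonglongrightarrow> 0"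
    proof (induction rule: complex_vector.span_induct_alt)
      case base
      then show ?case using D by (simp add: B_zero_right)
    next
      case (step c x y)
      then obtain f a where x: "x = J f a" by blast
      have "(\<lambda>n. B (s n) x) \<longlonglongrightarrow> 0" using s by (simp add: represents_def x)
      then have "(\<lambda>n. cnj c * B (s n) x + B (s n) y) \<longlonglongrightarrow> cnj c * 0 + 0"
        using step by (intro tendsto_intros) auto
      then show ?case using step D J_in_D by (simp add: x B_add_right B_scaleC_right)
    qed
    then show ?thesis ..
  qed
  obtain K where K: "K > 0" "\<And>n. N (s n) \<le> K" using N_Cauchy_bounded[OF C] by blast
  have "(\<lambda>n. (N (s n))\<^sup>2) \<longlonglongrightarrow> 0"
  proof (rule LIMSEQ_I)
    fix e :: real assume "e > 0"
    then obtain M where M: "\<And>m n. m \<ge> M \<Longrightarrow> n \<ge> M \<Longrightarrow> N (s m - s n) < e / (2 * K)"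
      using N_CauchyD[OF C, of "e / (2 * K)"] K(1) by auto
    obtain L where L: "\<And>n. n \<ge> L \<Longrightarrow> cmod (B (s n) (s M)) < e / 2"
      using LIMSEQ_D[OF weak[OF D[of M]], of "e/2"] \<open>e > 0\<close> by auto
    have "norm ((N (s n))\<^sup>2 - 0) < e" if "n \<ge> max M L" for n
    proof -
      have "(N (s n))\<^sup>2 = Re (B (s n) (s n - s M)) + Re (B (s n) (s M))"
        using D by (simp add: N_squared B_diff_right)
      also have "\<dots> \<le> cmod (B (s n) (s n - s M)) + cmod (B (s n) (s M))"
        by (intro add_mono complex_Re_le_cmod)
      also have "\<dots> \<le> K * N (s n - s M) + cmod (B (s n) (s M))"
        using Cauchy_Schwarz[of "s n" "s n - s M"] D K(2)[of n] N_nonneg[of "s n - s M"]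
        by (simp add: order_trans[OF _ mult_right_mono])
      also have "\<dots> < K * (e / (2 * K)) + e / 2"
        using M[of n M] L[of n] that K(1) by (intro add_strict_mono mult_strict_left_mono) auto
      also have "\<dots> = e" using K(1) by simp
      finally show ?thesis by simp
    qed
    then show "\<exists>no. \<forall>n\<ge>no. norm ((N (s n))\<^sup>2 - 0) < e" by blast
  qed
  then have "(\<lambda>n. sqrt ((N (s n))\<^sup>2)) \<longlonglongrightarrow> sqrt 0" by (rule tendsto_real_sqrt)
  then show ?thesis using D by (simp add: N_nonneg)
qed

lemma completion_ip_limit:
  assumes s: "represents s v" and t: "represents t w"
  shows "(\<lambda>n. B (s n) (t n)) \<longlonglongrightarrow> completion_ip v w"
proof -
  have v: "v \<in> completion" and w: "w \<in> completion"
    using s t by (auto intro: represents_in_completion)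
  let ?s = "rep_seq v" and ?t = "rep_seq w"
  have r: "represents ?s v" "represents ?t w" using v w by (auto intro: represents_rep_seq)
  have D: "s n \<in> D" "t n \<in> D" "?s n \<in> D" "?t n \<in> D" for n
    using s t r by (blast intro: represents_in_D)+
  have "represents (\<lambda>n. s n - ?s n) 0" "represents (\<lambda>n. t n - ?t n) 0"
    using represents_diff[OF s r(1)] represents_diff[OF t r(2)] by simp_all
  note null = this[THEN represents_zero_imp_null]
  have "(\<lambda>n. B (s n - ?s n) (t n)) \<longlonglongrightarrow> 0"
    by (rule B_null_Cauchy(1)[OF _ represents_Cauchy[OF t] null(1)]) (simp add: D)
  moreover have "(\<lambda>n. B (?s n) (t n - ?t n)) \<longlonglongrightarrow> 0"
    by (rule B_null_Cauchy(2)[OF _ represents_Cauchy[OF r(1)] null(2)]) (simp add: D)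
  moreover have "(\<lambda>n. B (?s n) (?t n)) \<longlonglongrightarrow> completion_ip v w"
    using B_convergent[OF r[THEN represents_Cauchy]] v w
    by (simp add: completion_ip_def convergent_LIMSEQ_iff)
  ultimately have "(\<lambda>n. B (s n - ?s n) (t n) + B (?s n) (t n - ?t n) + B (?s n) (?t n))
      \<longlonglongrightarrow> 0 + 0 + completion_ip v w"
    by (intro tendsto_add)
  then show ?thesis using D by (simp add: B_diff_left B_diff_right)
qed

lemma completion_norm_limit:
  assumes "represents s v"
  shows "(\<lambda>n. N (s n)) \<longlonglongrightarrow> inner_norm completion_ip v"
  unfolding inner_norm_def by (intro tendsto_intros completion_ip_limit assms)

lemma completion_semi_inner_space: "semi_inner_space completion completion_ip"
proof
  show "complex_vector.subspace completion"
    unfolding complex_vector.subspace_def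
  proof (intro conjI ballI allI)
    show "0 \<in> completion"
      using represents_diff[OF represents_embed represents_embed, of 0 0] represents_in_completion by force
    show "v + w \<in> completion" if "v \<in> completion" "w \<in> completion" for v w
      using represents_add[OF that[THEN represents_rep_seq]] by (rule represents_in_completion)
    show "c *\<^sub>C v \<in> completion" if "v \<in> completion" for c v
      using represents_scaleC[OF represents_rep_seq[OF that]] by (rule represents_in_completion)
  qed
next
  fix u v w :: "'f \<Rightarrow> 'a \<Rightarrow> complex" and c :: complex
  assume v: "v \<in> completion"
  note rv = represents_rep_seq[OF v]
  have Dv: "rep_seq v n \<in> D" for n by (rule represents_in_D[OF rv])
  show "0 \<le> Re (completion_ip v v)"
    by (rule LIMSEQ_le_const[OF tendsto_Re[OF completion_ip_limit[OF rv rv]]]) (simp add: B_nonneg Dv)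
  assume w: "w \<in> completion"
  note rw = represents_rep_seq[OF w]
  have Dw: "rep_seq w n \<in> D" for n by (rule represents_in_D[OF rw])
  show "completion_ip (c *\<^sub>C v) w = c * completion_ip v w"
    using completion_ip_limit[OF represents_scaleC[OF rv] rw, of c]
      tendsto_mult_left[OF completion_ip_limit[OF rv rw], of c]
    by (simp add: B_scaleC_left Dv Dw LIMSEQ_unique)
  show "cnj (completion_ip v w) = completion_ip w v"
    using completion_ip_limit[OF rw rv] tendsto_cnj[OF completion_ip_limit[OF rv rw]]
    by (simp add: B_cnj Dv Dw LIMSEQ_unique)
  assume u: "u \<in> completion"
  note ru = represents_rep_seq[OF u]
  have Du: "rep_seq u n \<in> D" for n by (rule represents_in_D[OF ru])
  show "completion_ip (v + w) u = completion_ip v u + completion_ip w u"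
    using completion_ip_limit[OF represents_add[OF rv rw] ru]
      tendsto_add[OF completion_ip_limit[OF rv ru] completion_ip_limit[OF rw ru]]
    by (simp add: B_add_left Du Dv Dw LIMSEQ_unique)
qed

sublocale completion: semi_inner_space completion completion_ip
  by (rule completion_semi_inner_space)

text \<open>
A vector of norm zero is represented by a null sequence, whose inner products with the generators
tend to zero by the Cauchy-Schwarz inequality.
\<close>
lemma completion_ip_definite:
  assumes v: "v \<in> completion" and "completion_ip v v = 0"
  shows "v = 0"
proof (intro ext)
  fix f a
  note rv = represents_rep_seq[OF v]
  have "(\<lambda>n. N (rep_seq v n)) \<longlonglongrightarrow> 0"
    using completion_norm_limit[OF rv] assms(2) by (simp add: inner_norm_def)
  then have "(\<lambda>n. B (rep_seq v n) (J f a)) \<longlonglongrightarrow> 0"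
    by (intro B_null_Cauchy(1) N_Cauchy_const J_in_D represents_in_D[OF rv])
  moreover have "(\<lambda>n. B (rep_seq v n) (J f a)) \<longlonglongrightarrow> v f a" using rv by (simp add: represents_def)
  ultimately show "v f a = 0 f a" using LIMSEQ_unique by auto
qed

lemma completion_ip_embed: "d \<in> D \<Longrightarrow> e \<in> D \<Longrightarrow> completion_ip (embed d) (embed e) = B d e"
  using completion_ip_limit[OF represents_embed represents_embed, of d e] by (simp add: LIMSEQ_const_iff)

lemma embed_norm: "d \<in> D \<Longrightarrow> inner_norm completion_ip (embed d) = N d"
  by (simp add: inner_norm_def completion_ip_embed)

lemma embed_in_completion: "d \<in> D \<Longrightarrow> embed d \<in> completion"
  using represents_embed represents_in_completion by blast

lemma embed_approximates:
  assumes v: "v \<in> completion" and "e > 0"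
  obtains d where "d \<in> D" and "inner_norm completion_ip (v - embed d) \<le> e"
proof -
  note rv = represents_rep_seq[OF v]
  obtain M where M: "\<And>m n. m \<ge> M \<Longrightarrow> n \<ge> M \<Longrightarrow> N (rep_seq v m - rep_seq v n) < e"
    using N_CauchyD[OF represents_Cauchy[OF rv] \<open>e > 0\<close>] by blast
  have D: "rep_seq v M \<in> D" by (rule represents_in_D[OF rv])
  have "inner_norm completion_ip (v - embed (rep_seq v M)) \<le> e"
    by (rule LIMSEQ_le_const2[OF completion_norm_limit[OF represents_diff[OF rv represents_embed[OF D]]]])
      (use M in \<open>force intro: less_imp_le\<close>)
  with D that show ?thesis by blast
qed

lemma embed_Cauchy_converges:
  assumes d: "N_Cauchy d"
  obtains v where "v \<in> completion" and "(\<lambda>k. inner_norm completion_ip (v - embed (d k))) \<longlonglongrightarrow> 0"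
proof -
  define v where "v f a = lim (\<lambda>n. B (d n) (J f a))" for f a
  have rv: "represents d v"
    using d B_convergent[OF d N_Cauchy_const[OF J_in_D]]
    by (simp add: represents_def v_def convergent_LIMSEQ_iff)
  have "(\<lambda>k. inner_norm completion_ip (v - embed (d k))) \<longlonglongrightarrow> 0"
  proof (rule LIMSEQ_I)
    fix e :: real assume "e > 0"
    then obtain M where M: "\<And>m n. m \<ge> M \<Longrightarrow> n \<ge> M \<Longrightarrow> N (d m - d n) < e / 2"
      using N_CauchyD[OF d, of "e/2"] by auto
    have "norm (inner_norm completion_ip (v - embed (d k)) - 0) < e" if "k \<ge> M" for k
    proof -
      have D: "d k \<in> D" using d by (rule N_Cauchy_in_D)
      have "inner_norm completion_ip (v - embed (d k)) \<le> e / 2"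
        by (rule LIMSEQ_le_const2[OF completion_norm_limit[OF represents_diff[OF rv represents_embed[OF D]]]])
          (use M that in \<open>force intro: less_imp_le\<close>)
      moreover have "0 \<le> inner_norm completion_ip (v - embed (d k))"
        using represents_in_completion[OF rv] embed_in_completion[OF D]
        by (intro completion.N_nonneg) simp
      ultimately show ?thesis using \<open>e > 0\<close> by simp
    qed
    then show "\<exists>no. \<forall>k\<ge>no. norm (inner_norm completion_ip (v - embed (d k)) - 0) < e" by blast
  qed
  then show ?thesis using that represents_in_completion[OF rv] by blast
qed

text \<open>
Replacing the \<open>k\<close>-th member of a Cauchy sequence by an element of \<open>D\<close> at distance at most
\<open>1 / (k + 1)\<close> gives a Cauchy sequence in \<open>D\<close>, which converges in the completion.
\<close>
theorem completion_hilbert_space: "hilbert_space completion completion_ip"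
proof
  show "completion_ip v v = 0 \<longleftrightarrow> v = 0" if "v \<in> completion" for v
    using completion_ip_definite[OF that] completion.B_scaleC_left[of 0 0 0] by auto
  let ?d = "\<lambda>v w. inner_norm completion_ip (v - w)"
  interpret M: Metric_space completion ?d
    by (rule completion.Metric_space_N) (auto intro: completion_ip_definite simp: completion_ip_def)
  show "M.mcomplete"
    unfolding M.mcomplete_def
  proof (intro allI impI)
    fix \<sigma> assume \<sigma>: "M.MCauchy \<sigma>"
    then have H: "\<sigma> k \<in> completion" for k unfolding M.MCauchy_def by blast
    have "\<exists>d. d \<in> D \<and> ?d (\<sigma> k) (embed d) \<le> inverse (real (Suc k))" for k
      using embed_approximates[OF H[of k], of "inverse (real (Suc k))"] by auto
    then obtain d where D: "\<And>k. d k \<in> D" and dk: "\<And>k. ?d (\<sigma> k) (embed (d k)) \<le> inverse (real (Suc k))"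
      by metis
    note E = embed_in_completion[OF D]
    have "N_Cauchy d"
      unfolding N_Cauchy_def
    proof (intro conjI allI impI D)
      fix e :: real assume "e > 0"
      then obtain L where L: "\<And>m n. m \<ge> L \<Longrightarrow> n \<ge> L \<Longrightarrow> ?d (\<sigma> m) (\<sigma> n) < e / 3"
        using \<sigma> unfolding M.MCauchy_def by (metis divide_pos_pos zero_less_numeral)
      obtain K where K: "inverse (real (Suc K)) < e / 3"
        using reals_Archimedean[of "e / 3"] \<open>e > 0\<close> by auto
      have "N (d m - d n) < e" if "m \<ge> max K L" "n \<ge> max K L" for m n
      proof -
        have small: "inverse (real (Suc k)) < e / 3" if "k \<ge> K" for k
        proof -
          have "inverse (real (Suc k)) \<le> inverse (real (Suc K))"
            using that by (intro le_imp_inverse_le) auto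
          then show ?thesis using K by linarith
        qed
        have "embed (d m) - embed (d n) = embed (d m - d n)"
          using D J_in_D by (simp add: fun_eq_iff embed_def B_diff_left)
        then have "N (d m - d n) = ?d (embed (d m)) (embed (d n))"
          using embed_norm[of "d m - d n"] D by simp
        also have "\<dots> \<le> ?d (embed (d m)) (\<sigma> m) + ?d (\<sigma> m) (embed (d n))"
          by (rule M.triangle[OF E H E])
        also have "?d (embed (d m)) (\<sigma> m) = ?d (\<sigma> m) (embed (d m))"
          by (rule M.commute)
        finally have "N (d m - d n) \<le> ?d (\<sigma> m) (embed (d m)) + ?d (\<sigma> m) (embed (d n))" .
        moreover have "?d (\<sigma> m) (embed (d n)) \<le> ?d (\<sigma> m) (\<sigma> n) + ?d (\<sigma> n) (embed (d n))"
          by (rule M.triangle[OF H H E])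
        ultimately have "N (d m - d n) \<le> ?d (\<sigma> m) (embed (d m)) + (?d (\<sigma> m) (\<sigma> n) + ?d (\<sigma> n) (embed (d n)))"
          by linarith
        then show ?thesis
          using dk[of m] dk[of n] small[of m] small[of n] L[of m n] that by linarith
      qed
      then show "\<exists>M. \<forall>m\<ge>M. \<forall>n\<ge>M. N (d m - d n) < e" by blast
    qed
    then obtain v where v: "v \<in> completion" and lim: "(\<lambda>k. ?d v (embed (d k))) \<longlonglongrightarrow> 0"
      by (rule embed_Cauchy_converges)
    have "(\<lambda>k. ?d v (embed (d k)) + inverse (real (Suc k))) \<longlonglongrightarrow> 0 + 0"
      by (intro tendsto_add lim LIMSEQ_inverse_real_of_nat)
    moreover have "?d (\<sigma> k) v \<le> ?d v (embed (d k)) + inverse (real (Suc k))" for k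
      using M.triangle[OF H[of k] E[of k] v] dk[of k] M.commute[of v "embed (d k)"] by linarith
    ultimately have "(\<lambda>k. ?d (\<sigma> k) v) \<longlonglongrightarrow> 0"
      by (intro tendsto_sandwich[of "\<lambda>_. 0" "\<lambda>k. ?d (\<sigma> k) v" sequentially]) auto
    then have "limitin M.mtopology \<sigma> v sequentially"
      unfolding M.limit_metric_sequentially using v H M.nonneg by (auto simp: LIMSEQ_iff)
    then show "\<exists>v. limitin M.mtopology \<sigma> v sequentially" by blast
  qed
qed (fact completion.subspace_D completion.B_add_left completion.B_scaleC_left completion.B_cnj
    completion.B_nonneg)+

end

section \<open>States of the algebra\<close>

lemma cstate_simps:
  assumes "cstate F"
  shows "F 1 = 1" "F (a + b) = F a + F b" "F (c *\<^sub>C a) = c * F a" "F (star a) = cnj (F a)"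
    "0 \<le> Re (F (star a * a))" "F (r *\<^sub>R a) = of_real r * F a" "F (a - b) = F a - F b" "F 0 = 0"
proof -
  show add: "F (a + b) = F a + F b" for a b using assms by (simp add: cstate_def)
  show "F 1 = 1" "F (c *\<^sub>C a) = c * F a" "F (star a) = cnj (F a)" "0 \<le> Re (F (star a * a))"
    "F (r *\<^sub>R a) = of_real r * F a"
    using assms by (simp_all add: cstate_def scaleR_scaleC)
  show "F (a - b) = F a - F b" using add[of "a - b" b] by simp
  show "F 0 = 0" using add[of 0 0] by simp
qed

lemma cstate_pos_cone:
  assumes "cstate F" "w \<in> pos_cone"
  shows "0 \<le> Re (F (star p * (w * p)))"
proof -
  obtain h where h: "h \<in> pos_cone" "h * h = w" using pos_cone_sqrt[OF assms(2)] by blast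
  have "star h = h" using h(1) by (simp add: pos_cone_def)
  then have "star (h * p) * (h * p) = star p * ((h * h) * p)"
    by (simp add: star_mult mult.assoc)
  then have "star (h * p) * (h * p) = star p * (w * p)" unfolding h(2) .
  then show ?thesis using cstate_simps(5)[OF assms(1), of "h * p"] by simp
qed

lemma cstate_selfadjoint_le:
  assumes F: "cstate F" and h: "star h = h"
  shows "Re (F h) \<le> norm h"
proof -
  have "norm h *\<^sub>R 1 - h \<in> pos_cone"
    unfolding pos_cone_def using h by (auto simp: star_diff star_scaleR intro!: exI[of _ "norm h"])
  then have "0 \<le> Re (F (norm h *\<^sub>R 1 - h))"
    using cstate_pos_cone[OF F, of _ 1] by simp
  then show ?thesis by (simp add: cstate_simps[OF F])
qed

text \<open>
The element \<open>(norm a)\<^sup>2 - star a * a\<close> is positive, so the inequality is positivity of the state at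
an element of the form \<open>star (h p) * (h p)\<close>. It is the reason why the representation below acts by
bounded operators.
\<close>
lemma cstate_left_mult_le:
  assumes F: "cstate F"
  shows "Re (F (star (a * p) * (a * p))) \<le> (norm a)\<^sup>2 * Re (F (star p * p))"
proof -
  have "(norm a)\<^sup>2 *\<^sub>R 1 - star a * a \<in> pos_cone"
    unfolding pos_cone_def
    by (auto simp: star_diff star_scaleR star_mult star_star cstar_identity intro!: exI[of _ "(norm a)\<^sup>2"])
  then have "0 \<le> Re (F (star p * (((norm a)\<^sup>2 *\<^sub>R 1 - star a * a) * p)))"
    by (rule cstate_pos_cone[OF F])
  also have "star p * (((norm a)\<^sup>2 *\<^sub>R 1 - star a * a) * p) = (norm a)\<^sup>2 *\<^sub>R (star p * p) - star (a * p) * (a * p)"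
    by (simp add: star_mult algebra_simps)
  finally show ?thesis by (simp add: cstate_simps[OF F])
qed

text \<open>
States of the unitization are described by their restrictions to the algebra, since the ambient
space of the Hilbert space is indexed by functionals on the algebra itself.
\<close>
definition extend :: "('a::cstar_algebra \<Rightarrow> complex) \<Rightarrow> 'a unitization \<Rightarrow> complex"
  where "extend f p = f (alg_part p) + scalar_part p"

text \<open>
The zero functional belongs to this set: its extension is the character with kernel the algebra.
Hence the Hilbert space below contains unit vectors even for the zero algebra.
\<close>
definition states :: "('a::cstar_algebra \<Rightarrow> complex) set"
  where "states = {f. cstate (extend f)}"

lemma star_Unitize: "star (Unitize a 0) = Unitize (star a) 0"
  by (simp add: star_unitization_def)

lemma Unitize_mult: "Unitize a 0 * Unitize b 0 = Unitize (a * b) (0::complex)"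
  by (rule unitization.expand) simp

lemma norming_state_nonunital:
  fixes b :: "'a::cstar_algebra"
  obtains f where "f \<in> states" and "f (star b * b) = norm (star b * b)"
proof -
  obtain F where F: "cstate F" and val: "F (star (Unitize b 0) * Unitize b 0) = norm (star (Unitize b 0) * Unitize b 0)"
    by (rule norming_state[of "Unitize b 0"])
  define f where "f a = F (Unitize a 0)" for a
  have "F p = extend f p" for p
    using cstate_simps(2,3)[OF F] cstate_simps(1)[OF F]
    by (subst unitization_decompose) (simp add: extend_def f_def)
  then have "extend f = F" by auto
  then have "f \<in> states" using F by (simp add: states_def)
  moreover have "f (star b * b) = norm (star b * b)"
    using val by (simp add: f_def star_Unitize Unitize_mult)
  ultimately show ?thesis using that by blast
qed

section \<open>The universal representation\<close>

text \<open>
The algebraic direct sum, over all states, of copies of the unitization, each carrying the form of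
its state. The completion is the Hilbert space sum of all GNS spaces.
\<close>
definition gns_families :: "(('a::cstar_algebra \<Rightarrow> complex) \<Rightarrow> 'a unitization) set"
  where "gns_families = {d. finite {f. d f \<noteq> 0} \<and> {f. d f \<noteq> 0} \<subseteq> states}"

definition gns_form :: "(('a::cstar_algebra \<Rightarrow> complex) \<Rightarrow> 'a unitization) \<Rightarrow> (('a \<Rightarrow> complex) \<Rightarrow> 'a unitization) \<Rightarrow> complex"
  where "gns_form d e = (\<Sum>f\<in>{f. d f \<noteq> 0}. extend f (star (e f) * d f))"

definition gns_single :: "('a::cstar_algebra \<Rightarrow> complex) \<Rightarrow> 'a unitization \<Rightarrow> ('a \<Rightarrow> complex) \<Rightarrow> 'a unitization"
  where "gns_single f p = (\<lambda>g. if g = f \<and> f \<in> states then p else 0)"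

text \<open>
The generator that belongs to \<open>a\<close> is the class of \<open>a + 1\<close> rather than that of \<open>a\<close>. The inner
products with the classes of the elements \<open>a\<close> alone would not determine a vector, because these
classes need not be dense in the GNS space of the unitization; for the zero functional they all
vanish. The classes of \<open>a + 1\<close>, however, span that space, the unit being the class for \<open>a = 0\<close>.
\<close>
definition gns_gen :: "('a::cstar_algebra \<Rightarrow> complex) \<Rightarrow> 'a \<Rightarrow> ('a \<Rightarrow> complex) \<Rightarrow> 'a unitization"
  where "gns_gen f a = gns_single f (Unitize a 1)"

lemma extend_states: "f \<in> states \<Longrightarrow> cstate (extend f)"
  by (simp add: states_def)

lemma gns_form_eq_sum:
  assumes "finite S" "S \<subseteq> states" "{f. d f \<noteq> 0} \<subseteq> S"
  shows "gns_form d e = (\<Sum>f\<in>S. extend f (star (e f) * d f))"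
  unfolding gns_form_def
  by (rule sum.mono_neutral_left) (use assms cstate_simps(8)[OF extend_states] in auto)

lemma gns_families_common_support:
  assumes "finite E" "E \<subseteq> gns_families"
  obtains S where "finite S" "S \<subseteq> states" "\<And>d. d \<in> E \<Longrightarrow> {f. d f \<noteq> 0} \<subseteq> S"
proof
  show "finite (\<Union>d\<in>E. {f. d f \<noteq> 0})" "(\<Union>d\<in>E. {f. d f \<noteq> 0}) \<subseteq> states"
    using assms by (auto simp: gns_families_def)
qed auto

lemma gns_families_subset:
  assumes "d \<in> gns_families" "{f. e f \<noteq> 0} \<subseteq> {f. d f \<noteq> 0}"
  shows "e \<in> gns_families"
  using assms finite_subset unfolding gns_families_def by blast

lemma gns_families_subspace: "complex_vector.subspace gns_families"
  unfolding complex_vector.subspace_def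
proof (intro conjI ballI allI)
  show "0 \<in> gns_families" by (simp add: gns_families_def)
  fix d e :: "('a \<Rightarrow> complex) \<Rightarrow> 'a unitization" and c :: complex
  assume d: "d \<in> gns_families"
  show "c *\<^sub>C d \<in> gns_families"
    using d by (rule gns_families_subset) (auto simp: scaleC_fun_def)
  assume e: "e \<in> gns_families"
  have "{f. (d + e) f \<noteq> 0} \<subseteq> {f. d f \<noteq> 0} \<union> {f. e f \<noteq> 0}" by auto
  with d e show "d + e \<in> gns_families"
    unfolding gns_families_def by (auto intro: finite_subset)
qed

lemma gns_single_in_families: "gns_single f p \<in> gns_families"
proof -
  have "{g. gns_single f p g \<noteq> 0} \<subseteq> {f} \<inter> states" by (auto simp: gns_single_def)
  then show ?thesis unfolding gns_families_def by (auto intro: finite_subset)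
qed

lemma gns_form_single:
  assumes f: "f \<in> states"
  shows "gns_form (gns_single f p) (gns_single f q) = extend f (star q * p)"
proof -
  have "gns_form (gns_single f p) (gns_single f q)
      = (\<Sum>g\<in>{f}. extend g (star (gns_single f q g) * gns_single f p g))"
    by (rule gns_form_eq_sum) (use f in \<open>auto simp: gns_single_def\<close>)
  then show ?thesis using f by (simp add: gns_single_def)
qed

text \<open>
On a single summand, \<open>a + l\<close> equals \<open>((a + 1) - (0 + 1)) + l (0 + 1)\<close>; the general case is an
induction on the support.
\<close>
lemma gns_families_span: "gns_families \<subseteq> complex_vector.span {gns_gen f a | f a. True}"
proof
  let ?span = "complex_vector.span {gns_gen f a | f (a::'a). True}"
  have gen: "gns_gen f a \<in> ?span" for f a by (rule complex_vector.span_base) blast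
  have single: "gns_single f p \<in> ?span" for f and p :: "'a unitization"
  proof -
    have "(Unitize (alg_part p) 1 - Unitize 0 1) + scalar_part p *\<^sub>C Unitize 0 1 = p"
      by (rule unitization.expand) simp
    then have "gns_single f p = (gns_gen f (alg_part p) - gns_gen f 0) + scalar_part p *\<^sub>C gns_gen f 0"
      by (simp add: fun_eq_iff gns_gen_def gns_single_def scaleC_fun_def)
    also have "\<dots> \<in> ?span"
      by (intro complex_vector.span_add complex_vector.span_diff complex_vector.span_scale gen)
    finally show ?thesis .
  qed
  have "d \<in> ?span" if "finite S" "S \<subseteq> states" "{f. d f \<noteq> 0} \<subseteq> S" for S and d :: "('a \<Rightarrow> complex) \<Rightarrow> 'a unitization"
    using that
  proof (induction S arbitrary: d rule: finite_induct)
    case empty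
    then have "d = 0" by auto
    then show ?case by (simp only: complex_vector.span_zero)
  next
    case (insert f S)
    have "d(f := 0) \<in> ?span" by (rule insert.IH) (use insert.prems in auto)
    then have "gns_single f (d f) + d(f := 0) \<in> ?span"
      by (rule complex_vector.span_add[OF single])
    moreover have "gns_single f (d f) + d(f := 0) = d"
      using insert.prems by (intro ext) (auto simp: gns_single_def)
    ultimately show ?case by simp
  qed
  then show "d \<in> ?span" if "d \<in> gns_families" for d
    using that by (auto simp: gns_families_def)
qed

global_interpretation gns: generated_semi_inner_space
  "gns_families :: (('a::cstar_algebra \<Rightarrow> complex) \<Rightarrow> 'a unitization) set" gns_form gns_gen
proof
  show "complex_vector.subspace (gns_families :: (('a \<Rightarrow> complex) \<Rightarrow> 'a unitization) set)"
    by (rule gns_families_subspace)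
  show "gns_families \<subseteq> complex_vector.span {gns_gen f (a::'a) | f a. True}"
    by (rule gns_families_span)
  show "gns_gen f (a::'a) \<in> gns_families" for f a
    unfolding gns_gen_def by (rule gns_single_in_families)
  fix x y z :: "('a \<Rightarrow> complex) \<Rightarrow> 'a unitization" and c :: complex
  assume x: "x \<in> gns_families"
  have "gns_form x x = (\<Sum>f\<in>{f. x f \<noteq> 0}. extend f (star (x f) * x f))"
    by (simp add: gns_form_def)
  then show "0 \<le> Re (gns_form x x)"
    using x cstate_simps(5)[OF extend_states] by (auto simp: gns_families_def intro!: sum_nonneg)
  assume y: "y \<in> gns_families"
  obtain S where S: "finite S" "S \<subseteq> states" "\<And>d. d \<in> {x, y} \<Longrightarrow> {f. d f \<noteq> 0} \<subseteq> S"
    using gns_families_common_support[of "{x, y}"] x y by blast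
  note st = cstate_simps[OF extend_states[OF subsetD[OF S(2)]]]
  have "{f. (c *\<^sub>C x) f \<noteq> 0} \<subseteq> S" using S(3)[of x] by (auto simp: scaleC_fun_def)
  then show "gns_form (c *\<^sub>C x) y = c * gns_form x y"
    using S by (simp add: gns_form_eq_sum[OF S(1,2)] scaleC_fun_def mult_scaleC_right st sum_distrib_left)
  show "cnj (gns_form x y) = gns_form y x"
    using S by (simp add: gns_form_eq_sum[OF S(1,2)] st(4)[symmetric] star_mult star_star)
  assume z: "z \<in> gns_families"
  obtain T where T: "finite T" "T \<subseteq> states" "\<And>d. d \<in> {x, y, x + y} \<Longrightarrow> {f. d f \<noteq> 0} \<subseteq> T"
    using gns_families_common_support[of "{x, y, x + y}"] x y
      complex_vector.subspace_add[OF gns_families_subspace x y] by blast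
  note st = cstate_simps[OF extend_states[OF subsetD[OF T(2)]]]
  have "gns_form (x + y) z = (\<Sum>f\<in>T. extend f (star (z f) * (x + y) f))"
    by (rule gns_form_eq_sum[OF T(1,2) T(3)[of "x + y"]]) blast
  then show "gns_form (x + y) z = gns_form x z + gns_form y z"
    using T by (simp add: gns_form_eq_sum[OF T(1,2)] distrib_left st sum.distrib)
qed

definition gns_act :: "'a::cstar_algebra \<Rightarrow> (('a \<Rightarrow> complex) \<Rightarrow> 'a unitization) \<Rightarrow> ('a \<Rightarrow> complex) \<Rightarrow> 'a unitization"
  where "gns_act a d = (\<lambda>f. Unitize a 0 * d f)"

lemma gns_act_in_families: "d \<in> gns_families \<Longrightarrow> gns_act a d \<in> gns_families"
  by (erule gns_families_subset) (auto simp: gns_act_def)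

lemma gns_act_adjoint:
  assumes d: "d \<in> gns_families" and e: "e \<in> gns_families"
  shows "gns_form (gns_act a d) e = gns_form d (gns_act (star a) e)"
proof -
  obtain S where S: "finite S" "S \<subseteq> states" "\<And>x. x \<in> {d, gns_act a d} \<Longrightarrow> {f. x f \<noteq> 0} \<subseteq> S"
    using gns_families_common_support[of "{d, gns_act a d}"] d gns_act_in_families[OF d] by blast
  show ?thesis
    using S by (simp add: gns_form_eq_sum[OF S(1,2)])
      (simp add: gns_act_def star_mult star_Unitize[symmetric] star_star mult.assoc)
qed

lemma gns_act_bound:
  assumes d: "d \<in> gns_families"
  shows "inner_norm gns_form (gns_act a d) \<le> norm a * inner_norm gns_form d"
proof -
  obtain S where S: "finite S" "S \<subseteq> states" "\<And>x. x \<in> {d, gns_act a d} \<Longrightarrow> {f. x f \<noteq> 0} \<subseteq> S"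
    using gns_families_common_support[of "{d, gns_act a d}"] d gns_act_in_families[OF d] by blast
  have "Re (gns_form (gns_act a d) (gns_act a d)) \<le> (norm a)\<^sup>2 * Re (gns_form d d)"
    using S cstate_left_mult_le[OF extend_states[OF subsetD[OF S(2)]], of _ "Unitize a 0"]
    by (simp add: gns_form_eq_sum[OF S(1,2)] sum_distrib_left) (simp add: gns_act_def sum_mono)
  then have "sqrt (Re (gns_form (gns_act a d) (gns_act a d))) \<le> sqrt ((norm a)\<^sup>2 * Re (gns_form d d))"
    by (rule real_sqrt_le_mono)
  then show ?thesis by (simp add: inner_norm_def real_sqrt_mult)
qed

lemma gns_act_diff: "gns_act a (d - e) = gns_act a d - gns_act a e"
  by (simp add: gns_act_def fun_eq_iff right_diff_distrib)

text \<open>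
The function that represents \<open>\<pi>(a) v\<close> takes at \<open>b\<close> the value of the inner product of \<open>v\<close> with the
class of \<open>star a * (b + 1) = ((star a * b + star a) + 1) - (0 + 1)\<close>, and is therefore given by an
explicit formula in terms of the function that represents \<open>v\<close>.
\<close>
definition gns_rep :: "'a::cstar_algebra \<Rightarrow> 'a gns_ambient \<Rightarrow> 'a gns_ambient"
  where "gns_rep a v = (\<lambda>f b. v f (star a * b + star a) - v f 0)"

text \<open>
The formula for the representation is the continuous extension of left multiplication, so the laws
of a representation pass from left multiplication to the completion by taking limits.
\<close>
lemma represents_gns_rep:
  assumes s: "gns.represents s v"
  shows "gns.represents (\<lambda>n. gns_act a (s n)) (gns_rep a v)"
  unfolding gns.represents_def
proof (intro conjI allI)
  have C: "gns.N_Cauchy s" and D: "\<And>n. s n \<in> gns_families"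
    using gns.represents_Cauchy[OF s] gns.N_Cauchy_in_D by blast+
  show "gns.N_Cauchy (\<lambda>n. gns_act a (s n))"
    by (rule gns.N_Cauchy_map[OF C gns_act_in_families gns_act_diff gns_act_bound])
  fix f b
  have "gns_act (star a) (gns_gen f b) = gns_gen f (star a * b + star a) - gns_gen f 0"
    by (auto simp: fun_eq_iff gns_act_def gns_gen_def gns_single_def scaleC_one intro: unitization.expand)
  then have "gns_form (gns_act a (s n)) (gns_gen f b)
      = gns_form (s n) (gns_gen f (star a * b + star a)) - gns_form (s n) (gns_gen f 0)" for n
    using D by (simp add: gns_act_adjoint gns.J_in_D gns.B_diff_right)
  then show "(\<lambda>n. gns_form (gns_act a (s n)) (gns_gen f b)) \<longlonglongrightarrow> gns_rep a v f b"
    using s by (simp add: gns_rep_def gns.represents_def tendsto_diff)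
qed

lemma gns_rep_in_completion: "v \<in> gns.completion \<Longrightarrow> gns_rep a v \<in> gns.completion"
  using represents_gns_rep gns.represents_rep_seq gns.represents_in_completion by blast

lemma gns_rep_embed: "d \<in> gns_families \<Longrightarrow> gns_rep a (gns.embed d) = gns.embed (gns_act a d)"
  by (rule gns.represents_unique[OF represents_gns_rep gns.represents_embed])
    (auto intro: gns_act_in_families gns.represents_embed)

definition gns_vector :: "('a::cstar_algebra \<Rightarrow> complex) \<Rightarrow> 'a gns_ambient"
  where "gns_vector f = gns.embed (gns_gen f 0)"

lemma gns_vector_in_completion: "gns_vector f \<in> gns.completion"
  by (simp add: gns_vector_def gns.embed_in_completion gns.J_in_D)

lemma gns_vector_state:
  assumes f: "f \<in> states"
  shows "gns.completion_ip (gns_rep a (gns_vector f)) (gns_vector f) = f a"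
proof -
  have act: "gns_act a (gns_gen f 0) = gns_single f (Unitize a 0)"
    by (auto simp: fun_eq_iff gns_act_def gns_gen_def gns_single_def scaleC_one intro: unitization.expand)
  have "gns.completion_ip (gns_rep a (gns_vector f)) (gns_vector f)
      = gns_form (gns_act a (gns_gen f 0)) (gns_gen f 0)"
    by (simp add: gns_vector_def gns_rep_embed gns.J_in_D gns.completion_ip_embed gns_act_in_families)
  also have "\<dots> = extend f (star (Unitize 0 1) * Unitize a 0)"
    unfolding act unfolding gns_gen_def by (rule gns_form_single[OF f])
  also have "\<dots> = f a" by (simp add: extend_def star_unitization_def scaleC_one)
  finally show ?thesis .
qed

lemma gns_vector_norm:
  assumes f: "f \<in> states"
  shows "inner_norm gns.completion_ip (gns_vector f) = 1"
proof -
  have "gns_form (gns_gen f 0) (gns_gen f 0) = extend f 1"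
    unfolding gns_gen_def gns_form_single[OF f]
    by (rule arg_cong[where f = "extend f"]) (rule unitization.expand, simp add: star_unitization_def)
  also have "\<dots> = 1" by (rule cstate_simps(1)[OF extend_states[OF f]])
  finally show ?thesis
    by (simp add: gns_vector_def inner_norm_def gns.completion_ip_embed gns.J_in_D)
qed

lemma gns_rep_add:
  assumes v: "v \<in> gns.completion"
  shows "gns_rep (a + b) v = gns_rep a v + gns_rep b v"
proof -
  note s = represents_gns_rep[OF gns.represents_rep_seq[OF v]]
  have "Unitize (a + b) 0 = Unitize a 0 + Unitize b 0" by (rule unitization.expand) simp
  then have "gns_act (a + b) d = gns_act a d + gns_act b d" for d
    by (simp add: gns_act_def fun_eq_iff distrib_right)
  then show ?thesis
    using s[of "a + b"] gns.represents_add[OF s[of a] s[of b]] by (simp add: gns.represents_unique)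
qed

lemma gns_rep_scaleC:
  assumes v: "v \<in> gns.completion"
  shows "gns_rep (c *\<^sub>C a) v = c *\<^sub>C gns_rep a v"
proof -
  note s = represents_gns_rep[OF gns.represents_rep_seq[OF v]]
  have "Unitize (c *\<^sub>C a) 0 = c *\<^sub>C Unitize a 0" by (rule unitization.expand) simp
  then have "gns_act (c *\<^sub>C a) d = c *\<^sub>C gns_act a d" for d
    by (simp add: gns_act_def fun_eq_iff scaleC_fun_def mult_scaleC_left)
  then show ?thesis
    using s[of "c *\<^sub>C a"] gns.represents_scaleC[OF s[of a], of c] by (simp add: gns.represents_unique)
qed

lemma gns_rep_mult:
  assumes v: "v \<in> gns.completion"
  shows "gns_rep (a * b) v = gns_rep a (gns_rep b v)"
proof -
  note s = represents_gns_rep[OF gns.represents_rep_seq[OF v]]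
  have "gns_act (a * b) d = gns_act a (gns_act b d)" for d
    by (simp add: gns_act_def Unitize_mult[symmetric] mult.assoc)
  then show ?thesis
    using s[of "a * b"] represents_gns_rep[OF s[of b], of a] by (simp add: gns.represents_unique)
qed

lemma gns_rep_star:
  assumes v: "v \<in> gns.completion" and w: "w \<in> gns.completion"
  shows "gns.completion_ip (gns_rep (star a) v) w = gns.completion_ip v (gns_rep a w)"
proof -
  note s = gns.represents_rep_seq[OF v] and t = gns.represents_rep_seq[OF w]
  show ?thesis
    using gns.completion_ip_limit[OF represents_gns_rep[OF s, of "star a"] t]
      gns.completion_ip_limit[OF s represents_gns_rep[OF t, of a]]
    by (simp add: gns_act_adjoint gns.represents_in_D[OF s] gns.represents_in_D[OF t] star_star LIMSEQ_unique)
qed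

lemma gns_rep_bound:
  assumes v: "v \<in> gns.completion"
  shows "inner_norm gns.completion_ip (gns_rep a v) \<le> norm a * inner_norm gns.completion_ip v"
proof -
  note s = gns.represents_rep_seq[OF v]
  show ?thesis
    by (rule LIMSEQ_le[OF gns.completion_norm_limit[OF represents_gns_rep[OF s]]
          tendsto_mult_left[OF gns.completion_norm_limit[OF s]]])
      (use gns_act_bound[OF gns.represents_in_D[OF s]] in blast)
qed

text \<open>
The vector state of a state that does not vanish at \<open>star c * c\<close> separates \<open>c\<close> from \<open>0\<close>.
\<close>
lemma gns_rep_faithful:
  assumes eq: "\<And>v. v \<in> gns.completion \<Longrightarrow> gns_rep a v = gns_rep b v"
  shows "a = (b :: 'a::cstar_algebra)"
proof -
  define c where "c = a - b"
  obtain f where f: "f \<in> states" "f (star c * c) = norm (star c * c)"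
    by (rule norming_state_nonunital)
  note v = gns_vector_in_completion[of f]
  have "gns_rep a (gns_vector f) = gns_rep c (gns_vector f) + gns_rep b (gns_vector f)"
    using gns_rep_add[OF v, of c b] by (simp add: c_def)
  then have "gns_rep c (gns_vector f) = 0" using eq[OF v] by simp
  then have "gns_rep (star c * c) (gns_vector f) = gns_rep (star c) 0"
    by (simp add: gns_rep_mult[OF v])
  also have "\<dots> = 0" by (simp add: gns_rep_def fun_eq_iff)
  finally have "f (star c * c) = gns.completion_ip 0 (gns_vector f)"
    using gns_vector_state[OF f(1), of "star c * c"] by simp
  also have "\<dots> = 0" using gns.completion.B_scaleC_left[of 0 "gns_vector f" 0] v by simp
  finally have "norm (star c * c) = 0" using f(2) by simp
  then have "c = 0" using cstar_identity[of c] by simp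
  then show ?thesis by (simp add: c_def)
qed

theorem gns_faithful_star_representation:
  "faithful_star_representation gns.completion gns.completion_ip (gns_rep :: 'a::cstar_algebra \<Rightarrow> _)"
proof -
  interpret hilbert_space "gns.completion :: 'a gns_ambient set" gns.completion_ip
    by (rule gns.completion_hilbert_space)
  show ?thesis
  proof
    fix a :: 'a
    show "bounded_operator_on gns.completion gns.completion_ip (gns_rep a)"
      unfolding bounded_operator_on_def
    proof (intro conjI ballI allI exI[of _ "norm a"])
      show "gns_rep a (v + w) = gns_rep a v + gns_rep a w" for v w
        by (simp add: gns_rep_def fun_eq_iff)
      show "gns_rep a (c *\<^sub>C v) = c *\<^sub>C gns_rep a v" for c v
        by (simp add: gns_rep_def scaleC_fun_def scaleC_complex_def fun_eq_iff algebra_simps)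
    qed (auto intro: gns_rep_in_completion gns_rep_bound)
  qed (simp_all add: gns_rep_add gns_rep_scaleC gns_rep_mult gns_rep_star gns_rep_faithful)
qed

section \<open>Norm-parallelism in Hilbert modules\<close>

text \<open>
The properties shared by the states that attain a norm and by the vector functionals of a
representation. Only these enter the estimates for the module norm.
\<close>
definition contractive_positive :: "('a::cstar_algebra \<Rightarrow> complex) \<Rightarrow> bool"
  where "contractive_positive \<phi> \<longleftrightarrow>
    (\<forall>a b. \<phi> (a + b) = \<phi> a + \<phi> b) \<and> (\<forall>c a. \<phi> (c *\<^sub>C a) = c * \<phi> a) \<and>
    (\<forall>a. \<phi> (star a) = cnj (\<phi> a)) \<and> (\<forall>a. 0 \<le> Re (\<phi> (star a * a))) \<and>
    (\<forall>a. star a = a \<longrightarrow> Re (\<phi> a) \<le> norm a)"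

lemma states_contractive_positive:
  assumes "f \<in> states"
  shows "contractive_positive f"
proof -
  note F = extend_states[OF assms]
  note st = cstate_simps[OF F]
  have f: "f a = extend f (Unitize a 0)" for a by (simp add: extend_def)
  show ?thesis
    unfolding contractive_positive_def
  proof (intro conjI allI impI)
    fix a b :: 'a and c :: complex
    show "f (a + b) = f a + f b" using st(2)[of "Unitize a 0" "Unitize b 0"] by (simp add: extend_def)
    show "f (c *\<^sub>C a) = c * f a" using st(3)[of c "Unitize a 0"] by (simp add: extend_def)
    show "f (star a) = cnj (f a)" using st(4)[of "Unitize a 0"] by (simp add: f star_Unitize)
    show "0 \<le> Re (f (star a * a))" using st(5)[of "Unitize a 0"] by (simp add: f star_Unitize Unitize_mult)
    show "Re (f a) \<le> norm a" if "star a = a"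
      using cstate_selfadjoint_le[OF F, of "Unitize a 0"] that by (simp add: f star_Unitize)
  qed
qed

lemma hilbert_space_semi_inner: "hilbert_space H br \<Longrightarrow> semi_inner_space H br"
  unfolding hilbert_space_def semi_inner_space_def by blast

text \<open>
Contractivity on self-adjoint elements again comes from a quasi square root: if \<open>2 b - b\<^sup>2 = k\<close>
with \<open>b\<close> self-adjoint, then the inner product of \<open>\<xi> - \<pi>(k) \<xi>\<close> with \<open>\<xi>\<close> is the square of the norm of
\<open>\<xi> - \<pi>(b) \<xi>\<close>, hence nonnegative.
\<close>
lemma vector_functional_contractive_positive:
  assumes rep: "faithful_star_representation H br \<pi>"
    and \<xi>: "\<xi> \<in> H" "inner_norm br \<xi> = 1"
  shows "contractive_positive (\<lambda>a. br (\<pi> a \<xi>) \<xi>)"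
proof -
  interpret faithful_star_representation H br \<pi> by (rule rep)
  interpret semi_inner_space H br
    by (rule hilbert_space_semi_inner) unfold_locales
  have in_H: "\<pi> a v \<in> H" if "v \<in> H" for a v
    using bounded_rep that by (auto simp: bounded_operator_on_def)
  have \<pi>_in_H: "\<pi> a \<xi> \<in> H" for a by (rule in_H[OF \<xi>(1)])
  have add: "br (\<pi> (a + b) \<xi>) \<xi> = br (\<pi> a \<xi>) \<xi> + br (\<pi> b \<xi>) \<xi>" for a b
    using \<xi> by (simp add: rep_add B_add_left \<pi>_in_H)
  have scale: "br (\<pi> (c *\<^sub>C a) \<xi>) \<xi> = c * br (\<pi> a \<xi>) \<xi>" for c a
    using \<xi> by (simp add: rep_scaleC B_scaleC_left \<pi>_in_H)
  have sq: "br (\<pi> (star a * a) \<xi>) \<xi> = br (\<pi> a \<xi>) (\<pi> a \<xi>)" for a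
    using \<xi> by (simp add: rep_mult rep_star \<pi>_in_H)
  have le: "Re (br (\<pi> a \<xi>) \<xi>) \<le> norm a" if sa: "star a = a" for a
  proof (cases "a = 0")
    case True
    then show ?thesis using scale[of 0 0] by simp
  next
    case False
    define k where "k = inverse (norm a) *\<^sub>R a"
    have k: "norm k \<le> 1" "star k = k" using False sa by (simp_all add: k_def star_scaleR)
    obtain b where b: "2 *\<^sub>R b - b * b = k" "star b = b"
      using quasi_square_root_cstar[OF k] by metis
    have "2 *\<^sub>C b = k + star b * b"
      using b by (simp add: scaleR_scaleC algebra_simps)
    then have "2 * br (\<pi> b \<xi>) \<xi> = br (\<pi> k \<xi>) \<xi> + br (\<pi> b \<xi>) (\<pi> b \<xi>)"
      using scale[of 2 b] add[of k "star b * b"] sq[of b] by simp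
    moreover have "br \<xi> (\<pi> b \<xi>) = br (\<pi> b \<xi>) \<xi>"
      using rep_star[OF \<xi>(1) \<xi>(1), of b] b(2) by simp
    ultimately have "br (\<xi> - \<pi> b \<xi>) (\<xi> - \<pi> b \<xi>) = br \<xi> \<xi> - br (\<pi> k \<xi>) \<xi>"
      using \<xi> \<pi>_in_H by (simp add: B_diff_left B_diff_right)
    then have "Re (br (\<pi> k \<xi>) \<xi>) \<le> Re (br \<xi> \<xi>)"
      using B_nonneg[of "\<xi> - \<pi> b \<xi>"] \<xi> \<pi>_in_H by simp
    also have "\<dots> = 1" using N_squared[OF \<xi>(1)] \<xi>(2) by simp
    finally have "norm a * Re (br (\<pi> k \<xi>) \<xi>) \<le> norm a * 1"
      by (rule mult_left_mono) simp
    moreover have "a = complex_of_real (norm a) *\<^sub>C k"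
      using False by (simp add: k_def scaleR_scaleC[symmetric])
    then have "br (\<pi> a \<xi>) \<xi> = of_real (norm a) * br (\<pi> k \<xi>) \<xi>" using scale by metis
    ultimately show ?thesis by simp
  qed
  show ?thesis
    unfolding contractive_positive_def
  proof (intro conjI allI impI add scale le)
    show "br (\<pi> (star a) \<xi>) \<xi> = cnj (br (\<pi> a \<xi>) \<xi>)" for a
      using \<xi> by (simp add: rep_star B_cnj \<pi>_in_H)
    show "0 \<le> Re (br (\<pi> (star a * a) \<xi>) \<xi>)" for a
      unfolding sq by (rule B_nonneg[OF \<pi>_in_H])
  qed
qed

context hilbert_module
begin

lemma ip_add_left: "ip (x + y) z = ip x z + ip y z"
  by (metis ip_add_right star_add star_ip)

lemma ip_scaleC_left: "ip (c *\<^sub>C x) y = cnj c *\<^sub>C ip x y"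
  by (metis ip_scaleC_right star_scaleC star_ip)

lemma module_norm_nonneg: "0 \<le> module_norm ip x"
  by (simp add: module_norm_def)

lemma module_norm_squared: "(module_norm ip x)\<^sup>2 = norm (ip x x)"
  by (simp add: module_norm_def)

lemma module_norm_unimodular: "cmod \<mu> = 1 \<Longrightarrow> module_norm ip (\<mu> *\<^sub>C y) = module_norm ip y"
  by (simp add: module_norm_def ip_scaleC_left ip_scaleC_right norm_scaleC norm_mult)

context
  fixes \<phi> :: "'a \<Rightarrow> complex"
  assumes \<phi>: "contractive_positive \<phi>"
begin

lemma functional_ip_nonneg: "0 \<le> Re (\<phi> (ip x x))"
  using ip_nonneg[of x] \<phi> by (auto simp: cstar_nonneg_def contractive_positive_def)

lemma functional_ip_le: "Re (\<phi> (ip x x)) \<le> (module_norm ip x)\<^sup>2"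
  using \<phi> star_ip[of x x] by (simp add: contractive_positive_def module_norm_squared)

lemma functional_ip_expand:
  "Re (\<phi> (ip (x + z) (x + z))) = Re (\<phi> (ip x x)) + Re (\<phi> (ip z z)) + 2 * Re (\<phi> (ip x z))"
proof -
  have "\<phi> (ip z x) = cnj (\<phi> (ip x z))"
    using \<phi> by (metis contractive_positive_def star_ip)
  then show ?thesis
    using \<phi> by (simp add: contractive_positive_def ip_add_left ip_add_right)
qed

lemma functional_ip_Cauchy_Schwarz:
  "(Re (\<phi> (ip x z)))\<^sup>2 \<le> Re (\<phi> (ip x x)) * Re (\<phi> (ip z z))"
proof -
  interpret semi_inner_space "UNIV :: 'x set" "\<lambda>u v. \<phi> (ip v u)"
  proof
    show "cnj (\<phi> (ip v u)) = \<phi> (ip u v)" for u v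
      using \<phi> by (metis contractive_positive_def star_ip)
  qed (use \<phi> functional_ip_nonneg in
      \<open>simp_all add: contractive_positive_def ip_add_right ip_scaleC_right complex_vector.subspace_UNIV\<close>)
  have "\<bar>Re (\<phi> (ip x z))\<bar> \<le> N z * N x"
    using Cauchy_Schwarz[of z x] abs_Re_le_cmod[of "\<phi> (ip x z)"] by simp
  then have "\<bar>Re (\<phi> (ip x z))\<bar>\<^sup>2 \<le> (N z * N x)\<^sup>2" by (rule power_mono) simp
  then show ?thesis by (simp add: power_mult_distrib N_squared mult.commute)
qed

lemma functional_ip_le_norms: "Re (\<phi> (ip x z)) \<le> module_norm ip x * module_norm ip z"
proof -
  have "(Re (\<phi> (ip x z)))\<^sup>2 \<le> (module_norm ip x)\<^sup>2 * (module_norm ip z)\<^sup>2"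
    using functional_ip_Cauchy_Schwarz[of x z]
      mult_mono[OF functional_ip_le[of x] functional_ip_le[of z]] functional_ip_nonneg[of z]
    by simp
  then have "\<bar>Re (\<phi> (ip x z))\<bar> \<le> \<bar>module_norm ip x * module_norm ip z\<bar>"
    unfolding abs_le_square_iff by (simp add: power_mult_distrib)
  then show ?thesis by (simp add: module_norm_nonneg)
qed

text \<open>
By the Cauchy-Schwarz inequality, a large value of \<open>\<phi>\<close> at the mixed term forces large values at
\<open>ip x x\<close> and \<open>ip z z\<close>. As \<open>Re (\<phi> (ip x z))\<close> tends to the product of the norms of \<open>x\<close> and \<open>z\<close>,
the left-hand side tends to the square of the sum of these norms.
\<close>
lemma functional_ip_lower_bound:
  assumes "x \<noteq> 0" "z \<noteq> 0"
  shows "(Re (\<phi> (ip x z)) / module_norm ip z)\<^sup>2 + (Re (\<phi> (ip x z)) / module_norm ip x)\<^sup>2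
      + 2 * Re (\<phi> (ip x z)) \<le> (module_norm ip (x + z))\<^sup>2"
proof -
  have pos: "0 < module_norm ip x" "0 < module_norm ip z"
    using assms ip_eq_0_iff by (simp_all add: module_norm_def)
  have "(Re (\<phi> (ip x z)))\<^sup>2 \<le> Re (\<phi> (ip x x)) * (module_norm ip z)\<^sup>2"
    using functional_ip_Cauchy_Schwarz[of x z]
      mult_left_mono[OF functional_ip_le[of z] functional_ip_nonneg[of x]] by linarith
  then have 1: "(Re (\<phi> (ip x z)) / module_norm ip z)\<^sup>2 \<le> Re (\<phi> (ip x x))"
    using pos by (simp add: power_divide divide_le_eq)
  have "(Re (\<phi> (ip x z)))\<^sup>2 \<le> (module_norm ip x)\<^sup>2 * Re (\<phi> (ip z z))"
    using functional_ip_Cauchy_Schwarz[of x z]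
      mult_right_mono[OF functional_ip_le[of x] functional_ip_nonneg[of z]] by linarith
  then have 2: "(Re (\<phi> (ip x z)) / module_norm ip x)\<^sup>2 \<le> Re (\<phi> (ip z z))"
    using pos by (simp add: power_divide divide_le_eq mult.commute)
  show ?thesis
    using 1 2 functional_ip_le[of "x + z"] functional_ip_expand[of x z] by linarith
qed

end

lemma norming_state_sum:
  obtains f where "f \<in> states"
    and "(module_norm ip (x + z))\<^sup>2 = Re (f (ip x x)) + Re (f (ip z z)) + 2 * Re (f (ip x z))"
proof -
  obtain b where b: "ip (x + z) (x + z) = star b * b"
    using ip_nonneg[of "x + z"] by (auto simp: cstar_nonneg_def)
  obtain f where f: "f \<in> states" "f (star b * b) = norm (star b * b)"
    by (rule norming_state_nonunital)
  have "(module_norm ip (x + z))\<^sup>2 = Re (f (ip (x + z) (x + z)))"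
    using f(2) by (simp add: b module_norm_squared)
  then show ?thesis
    using that[OF f(1)] functional_ip_expand[OF states_contractive_positive[OF f(1)], of x z] by simp
qed

lemma module_norm_triangle: "module_norm ip (x + z) \<le> module_norm ip x + module_norm ip z"
proof -
  obtain f where f: "f \<in> states"
    and eq: "(module_norm ip (x + z))\<^sup>2 = Re (f (ip x x)) + Re (f (ip z z)) + 2 * Re (f (ip x z))"
    by (rule norming_state_sum)
  note \<phi> = states_contractive_positive[OF f]
  have "(module_norm ip (x + z))\<^sup>2 \<le> (module_norm ip x + module_norm ip z)\<^sup>2"
    using eq functional_ip_le[OF \<phi>, of x] functional_ip_le[OF \<phi>, of z] functional_ip_le_norms[OF \<phi>, of x z]
    by (simp add: power2_sum)
  then show ?thesis by (rule power2_le_imp_le) (simp add: module_norm_nonneg)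
qed

text \<open>
The three summands of the identity in the preceding choice of state are bounded by the three
summands of the square of the sum of the norms. Equality of the sums forces equality of the mixed
terms.
\<close>
lemma norm_additive_imp_state:
  assumes "module_norm ip (x + z) = module_norm ip x + module_norm ip z"
  obtains f where "f \<in> states" and "Re (f (ip x z)) = module_norm ip x * module_norm ip z"
proof -
  obtain f where f: "f \<in> states"
    and eq: "(module_norm ip (x + z))\<^sup>2 = Re (f (ip x x)) + Re (f (ip z z)) + 2 * Re (f (ip x z))"
    by (rule norming_state_sum)
  note \<phi> = states_contractive_positive[OF f]
  have "Re (f (ip x z)) = module_norm ip x * module_norm ip z"
    using eq functional_ip_le[OF \<phi>, of x] functional_ip_le[OF \<phi>, of z] functional_ip_le_norms[OF \<phi>, of x z]
    unfolding assms by (simp add: power2_sum)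
  with f that show ?thesis by blast
qed

lemma norm_parallel_imp_limit:
  assumes "norm_parallel (module_norm ip) x y"
  shows "norm_product_limit TYPE('a gns_ambient) ip x y"
proof -
  obtain \<mu> where \<mu>: "cmod \<mu> = 1" "module_norm ip (x + \<mu> *\<^sub>C y) = module_norm ip x + module_norm ip y"
    using assms by (auto simp: norm_parallel_def)
  then obtain f where f: "f \<in> states" "Re (f (ip x (\<mu> *\<^sub>C y))) = module_norm ip x * module_norm ip y"
    using norm_additive_imp_state[of x "\<mu> *\<^sub>C y"] by (auto simp: module_norm_unimodular)
  show ?thesis
    unfolding norm_product_limit_def
    by (intro exI[of _ gns.completion] exI[of _ gns.completion_ip] exI[of _ gns_rep]
        exI[of _ "\<lambda>_. gns_vector f"] exI[of _ \<mu>])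
      (simp add: gns_faithful_star_representation \<mu>(1) gns_vector_in_completion
        gns_vector_norm[OF f(1)] gns_vector_state[OF f(1)] f(2))
qed

lemma limit_imp_norm_parallel:
  assumes "norm_product_limit TYPE('h::complex_vector) ip x y"
  shows "norm_parallel (module_norm ip) x y"
proof -
  obtain H and br :: "'h \<Rightarrow> 'h \<Rightarrow> complex" and \<pi> and \<xi> :: "nat \<Rightarrow> 'h" and \<mu> where
    rep: "faithful_star_representation H br \<pi>"
    and \<xi>: "\<And>n. \<xi> n \<in> H" "\<And>n. inner_norm br (\<xi> n) = 1" and \<mu>: "cmod \<mu> = 1"
    and lim: "(\<lambda>n. Re (br (\<pi> (ip x (\<mu> *\<^sub>C y)) (\<xi> n)) (\<xi> n))) \<longlonglongrightarrow> module_norm ip x * module_norm ip y"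
    using assms unfolding norm_product_limit_def by blast
  define z where "z = \<mu> *\<^sub>C y"
  have nz: "module_norm ip z = module_norm ip y" using \<mu> by (simp add: z_def module_norm_unimodular)
  have zero: "module_norm ip 0 = 0" using ip_eq_0_iff[of 0] by (simp add: module_norm_def)
  have "module_norm ip x + module_norm ip z \<le> module_norm ip (x + z)"
  proof (cases "x = 0 \<or> z = 0")
    case True
    then show ?thesis using zero by auto
  next
    case False
    then have pos: "module_norm ip x \<noteq> 0" "module_norm ip z \<noteq> 0"
      using ip_eq_0_iff by (simp_all add: module_norm_def)
    let ?r = "\<lambda>n. Re (br (\<pi> (ip x z) (\<xi> n)) (\<xi> n))"
    have lim: "?r \<longlonglongrightarrow> module_norm ip x * module_norm ip z" using lim by (simp add: z_def[symmetric] nz)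
    have "(\<lambda>n. (?r n / module_norm ip z)\<^sup>2 + (?r n / module_norm ip x)\<^sup>2 + 2 * ?r n) \<longlonglongrightarrow>
        (module_norm ip x * module_norm ip z / module_norm ip z)\<^sup>2
        + (module_norm ip x * module_norm ip z / module_norm ip x)\<^sup>2
        + 2 * (module_norm ip x * module_norm ip z)"
      by (intro tendsto_intros lim pos)
    moreover have "(?r n / module_norm ip z)\<^sup>2 + (?r n / module_norm ip x)\<^sup>2 + 2 * ?r n
        \<le> (module_norm ip (x + z))\<^sup>2" for n
      using functional_ip_lower_bound[OF vector_functional_contractive_positive[OF rep \<xi>[of n]]] False by simp
    ultimately have "(module_norm ip x * module_norm ip z / module_norm ip z)\<^sup>2
        + (module_norm ip x * module_norm ip z / module_norm ip x)\<^sup>2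
        + 2 * (module_norm ip x * module_norm ip z) \<le> (module_norm ip (x + z))\<^sup>2"
      by (intro LIMSEQ_le_const2) auto
    then have "(module_norm ip x + module_norm ip z)\<^sup>2 \<le> (module_norm ip (x + z))\<^sup>2"
      using pos by (simp add: power2_sum)
    then show ?thesis by (rule power2_le_imp_le) (rule module_norm_nonneg)
  qed
  then have "module_norm ip (x + z) = module_norm ip x + module_norm ip y"
    using module_norm_triangle[of x z] nz by simp
  then show ?thesis using \<mu> unfolding norm_parallel_def z_def by blast
qed

end

(* The second conjunct, with 'h arbitrary, shows that the choice of ambient space in the first
   one is no restriction on the Hilbert space. *)
theorem theorem2p3:
  fixes act :: "'x::complex_vector \<Rightarrow> 'a::cstar_algebra \<Rightarrow> 'x"
    and ip :: "'x \<Rightarrow> 'x \<Rightarrow> 'a"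
    and x y :: 'x
  assumes "hilbert_module act ip"
  shows "(norm_parallel (module_norm ip) x y \<longleftrightarrow>
            norm_product_limit TYPE('a gns_ambient) ip x y) \<and>
         (norm_product_limit TYPE('h::complex_vector) ip x y \<longrightarrow>
            norm_parallel (module_norm ip) x y)"
proof (intro conjI iffI impI)
  show "norm_product_limit TYPE('a gns_ambient) ip x y" if "norm_parallel (module_norm ip) x y"
    by (rule hilbert_module.norm_parallel_imp_limit[OF assms that])
  show "norm_parallel (module_norm ip) x y" if "norm_product_limit TYPE('a gns_ambient) ip x y"
    by (rule hilbert_module.limit_imp_norm_parallel[OF assms that])
  show "norm_parallel (module_norm ip) x y" if "norm_product_limit TYPE('h) ip x y"
    by (rule hilbert_module.limit_imp_norm_parallel[OF assms that])
qed

end
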